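(* Let $\lambda=0$ and $\delta>0$, let $k$ be a positive constant, and let $G:L^2(0,T)\to L^2(0,T;L^2(0,L))\times L^2(0,T;L^2(0,L))$ map a control $\psi$ to the state $(u,p)$ solving the one-dimensional poroviscoelastic system $$H_v u_{xxt}+H_e u_{xx}-p_x=0,\qquad u_{xt}-k p_{xx}=0\quad\text{in }[0,L]\times[0,T],$$ $$u(0,t)=p(0,t)=0,\quad -k p_x(L,t)=\psi(t),\quad H_v u_{xt}(L,t)+H_e u_x(L,t)-p(L,t)=0\quad(t\in[0,T]),\qquad u_x(x,0)=0\quad(x\in[0,L]).$$ Let $j:L^2(0,T)\to\mathbb{R}$, $$j(\psi)=\tfrac12\|u-u_d\|_{L^2(0,T;L^2(0,L))}^2+\tfrac12\|p-p_d\|_{L^2(0,T;L^2(0,L))}^2,\qquad (u,p)=G\psi+(\tilde u,\tilde p).$$ Then there does not exist $C>0$ such that $$|\nabla^2 j(w)(\xi,\varphi)|\le C\|\xi\|_{L^1(0,T)}\|\varphi\|_{L^1(0,T)}\quad\text{for all }w,\xi,\varphi\in L^2(0,T).$$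
   Context: $T,L>0$; $H_e=\lambda_e+2\mu_e$ and $H_v=\delta(\lambda_v+2\mu_v)$ with $\lambda_e,\mu_e,\lambda_v,\mu_v>0$. $u_d,p_d,\tilde u,\tilde p\in L^2(0,T;L^2(0,L))$ are fixed given functions ($(\tilde u,\tilde p)$ is the state produced by the remaining given data with zero control). Subscripts $x,t$ denote partial derivatives. For $\psi\in L^2(0,T)$ the state is the unique weak solution: with $V_0=\{v\in H^1(0,L):v(0)=0\}$, $u\in H^1(0,T;V_0)$, $p\in L^2(0,T;V_0)$, $u(\cdot,0)=0$, such that for a.a. $t$: $\int_0^L(H_v u_{xt}+H_e u_x-p)v_x\,dx=0$ and $(u_{xt},q)_{L^2(0,L)}+k(p_x,q_x)_{L^2(0,L)}+\psi(t)q(L)=0$ for all $v,q\in V_0$. This solution exists, is unique, and depends linearly and continuously on $\psi\in L^2(0,T)$ (known well-posedness); $j$ is twice Fréchet differentiable. *)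

theory Defs
  imports "HOL-Analysis.Analysis"
begin

section \<open>Lebesgue spaces\<close>

text \<open>
  Elements of Lebesgue, Sobolev and Bochner spaces are represented by measurable functions; equality
  in these spaces is equality almost everywhere. The measure on the interval (0,b) is
  \<open>leb b\<close>.
\<close>

abbreviation leb :: "real \<Rightarrow> real measure" where
  "leb b \<equiv> restrict_space lborel {0<..<b}"

definition L2 :: "'a measure \<Rightarrow> ('a \<Rightarrow> real) set" where
  "L2 M = {f \<in> borel_measurable M. integrable M (\<lambda>x. (f x)\<^sup>2)}"

definition L2_norm :: "'a measure \<Rightarrow> ('a \<Rightarrow> real) \<Rightarrow> real" where
  "L2_norm M f = sqrt (LINT x|M. (f x)\<^sup>2)"

definition L1_norm :: "'a measure \<Rightarrow> ('a \<Rightarrow> real) \<Rightarrow> real" where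
  "L1_norm M f = (LINT x|M. \<bar>f x\<bar>)"

text \<open>
  The Bochner space \<open>L\<^sup>2(0,T;L\<^sup>2(0,L))\<close>. A function is written \<open>f t x\<close>, so that
  \<open>f t\<close> is its value at time \<open>t\<close>. Since \<open>L\<^sup>2(0,L)\<close> is separable, strongly measurable maps
  \<open>(0,T) \<rightarrow> L\<^sup>2(0,L)\<close> are exactly those that have a jointly measurable representative.
\<close>

definition L2L2 :: "real \<Rightarrow> real \<Rightarrow> (real \<Rightarrow> real \<Rightarrow> real) set" where
  "L2L2 T L = {f. case_prod f \<in> borel_measurable (leb T \<Otimes>\<^sub>M leb L) \<and>
                  (AE t in leb T. f t \<in> L2 (leb L)) \<and>
                  (\<lambda>t. L2_norm (leb L) (f t)) \<in> L2 (leb T)}"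

definition L2L2_norm :: "real \<Rightarrow> real \<Rightarrow> (real \<Rightarrow> real \<Rightarrow> real) \<Rightarrow> real" where
  "L2L2_norm T L f = L2_norm (leb T) (\<lambda>t. L2_norm (leb L) (f t))"

section \<open>Sobolev spaces on an interval\<close>

text \<open>Test functions: \<open>C\<^sup>1\<close> functions with compact support in (0,b).\<close>

definition test_fun :: "real \<Rightarrow> (real \<Rightarrow> real) \<Rightarrow> bool" where
  "test_fun b \<phi> \<longleftrightarrow> (\<forall>x. \<phi> differentiable at x) \<and> continuous_on UNIV (deriv \<phi>) \<and>
     (\<exists>c d. 0 < c \<and> d < b \<and> (\<forall>x. x \<notin> {c..d} \<longrightarrow> \<phi> x = 0))"

definition weak_deriv :: "real \<Rightarrow> (real \<Rightarrow> real) \<Rightarrow> (real \<Rightarrow> real) \<Rightarrow> bool" where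
  "weak_deriv b v g \<longleftrightarrow> v \<in> L2 (leb b) \<and> g \<in> L2 (leb b) \<and>
     (\<forall>\<phi>. test_fun b \<phi> \<longrightarrow>
        (LINT x|leb b. v x * deriv \<phi> x) = - (LINT x|leb b. g x * \<phi> x))"

definition H1 :: "real \<Rightarrow> (real \<Rightarrow> real) set" where
  "H1 b = {v. \<exists>g. weak_deriv b v g}"

text \<open>
  The value at \<open>a \<in> [0,b]\<close> of an element of \<open>H\<^sup>1(0,b)\<close> is the value of its unique
  representative that is continuous on \<open>[0,b]\<close>.
\<close>

definition point_val :: "real \<Rightarrow> (real \<Rightarrow> real) \<Rightarrow> real \<Rightarrow> real" where
  "point_val b v a = (THE y. \<exists>c. continuous_on {0..b} c \<and> (AE x in leb b. c x = v x) \<and> c a = y)"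

definition V0 :: "real \<Rightarrow> (real \<Rightarrow> real) set" where
  "V0 b = {v \<in> H1 b. point_val b v 0 = 0}"

text \<open>\<open>f \<in> L\<^sup>2(0,T;V\<^sub>0)\<close> with spatial derivative \<open>f\<^sub>x = fx\<close>.\<close>

definition L2V0 :: "real \<Rightarrow> real \<Rightarrow> (real \<Rightarrow> real \<Rightarrow> real) \<Rightarrow> (real \<Rightarrow> real \<Rightarrow> real) \<Rightarrow> bool" where
  "L2V0 T L f fx \<longleftrightarrow> f \<in> L2L2 T L \<and> fx \<in> L2L2 T L \<and>
     (AE t in leb T. f t \<in> V0 L \<and> weak_deriv L (f t) (fx t))"

text \<open>
  Weak time derivative of a \<open>V\<^sub>0\<close>-valued function. Both sides are Bochner integrals, hence elements
  of \<open>V\<^sub>0\<close>, which coincide iff they agree for almost every \<open>x\<close>.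
\<close>

definition weak_time_deriv ::
    "real \<Rightarrow> real \<Rightarrow> (real \<Rightarrow> real \<Rightarrow> real) \<Rightarrow> (real \<Rightarrow> real \<Rightarrow> real) \<Rightarrow> bool" where
  "weak_time_deriv T L f ft \<longleftrightarrow>
     (\<forall>\<phi>. test_fun T \<phi> \<longrightarrow>
        (AE x in leb L. (LINT t|leb T. f t x * deriv \<phi> t) = - (LINT t|leb T. ft t x * \<phi> t)))"

text \<open>
  \<open>f(\<cdot>,0) = 0\<close> for \<open>f \<in> H\<^sup>1(0,T;V\<^sub>0) \<subseteq> C([0,T];V\<^sub>0)\<close>: the representative \<open>c\<close> that is continuous
  in time with respect to the \<open>H\<^sup>1(0,L)\<close> norm vanishes at time 0.
\<close>

definition initial_zero :: "real \<Rightarrow> real \<Rightarrow> (real \<Rightarrow> real \<Rightarrow> real) \<Rightarrow> bool" where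
  "initial_zero T L f \<longleftrightarrow>
     (\<exists>c cx. (\<forall>t\<in>{0..T}. c t \<in> V0 L \<and> weak_deriv L (c t) (cx t)) \<and>
        (\<forall>s\<in>{0..T}. ((\<lambda>t. sqrt ((L2_norm (leb L) (\<lambda>x. c t x - c s x))\<^sup>2 +
                                  (L2_norm (leb L) (\<lambda>x. cx t x - cx s x))\<^sup>2))
                      \<longlongrightarrow> 0) (at s within {0..T})) \<and>
        (AE t in leb T. AE x in leb L. c t x = f t x) \<and>
        (AE x in leb L. c 0 x = 0))"

section \<open>The poroviscoelastic system\<close>

definition weak_solution :: "real \<Rightarrow> real \<Rightarrow> real \<Rightarrow> real \<Rightarrow> real \<Rightarrow> (real \<Rightarrow> real) \<Rightarrow>
    (real \<Rightarrow> real \<Rightarrow> real) \<Rightarrow> (real \<Rightarrow> real \<Rightarrow> real) \<Rightarrow> bool" where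
  "weak_solution T L Hv He k \<psi> u p \<longleftrightarrow>
     (\<exists>ux ut uxt px.
        L2V0 T L u ux \<and> L2V0 T L ut uxt \<and> weak_time_deriv T L u ut \<and> initial_zero T L u \<and>
        L2V0 T L p px \<and>
        (AE t in leb T.
           (\<forall>v vx. v \<in> V0 L \<and> weak_deriv L v vx \<longrightarrow>
              (LINT x|leb L. (Hv * uxt t x + He * ux t x - p t x) * vx x) = 0) \<and>
           (\<forall>q qx. q \<in> V0 L \<and> weak_deriv L q qx \<longrightarrow>
              (LINT x|leb L. uxt t x * q x) + k * (LINT x|leb L. px t x * qx x)
                + \<psi> t * point_val L q L = 0)))"

definition tracking_cost :: "real \<Rightarrow> real \<Rightarrow>
    ((real \<Rightarrow> real) \<Rightarrow> (real \<Rightarrow> real \<Rightarrow> real) \<times> (real \<Rightarrow> real \<Rightarrow> real)) \<Rightarrow>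
    (real \<Rightarrow> real \<Rightarrow> real) \<Rightarrow> (real \<Rightarrow> real \<Rightarrow> real) \<Rightarrow>
    (real \<Rightarrow> real \<Rightarrow> real) \<Rightarrow> (real \<Rightarrow> real \<Rightarrow> real) \<Rightarrow> (real \<Rightarrow> real) \<Rightarrow> real" where
  "tracking_cost T L G u_til p_til u_d p_d \<psi> =
     1 / 2 * (L2L2_norm T L (\<lambda>t x. fst (G \<psi>) t x + u_til t x - u_d t x))\<^sup>2 +
     1 / 2 * (L2L2_norm T L (\<lambda>t x. snd (G \<psi>) t x + p_til t x - p_d t x))\<^sup>2"

section \<open>Frechet derivatives of functionals on L2\<close>

text \<open>Bounded linear functionals; boundedness makes them independent of representatives.\<close>

definition L2_dual :: "'a measure \<Rightarrow> (('a \<Rightarrow> real) \<Rightarrow> real) set" where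
  "L2_dual M = {F.
     (\<forall>f\<in>L2 M. \<forall>g\<in>L2 M. \<forall>a b. F (\<lambda>x. a * f x + b * g x) = a * F f + b * F g) \<and>
     (\<exists>K. \<forall>f\<in>L2 M. \<bar>F f\<bar> \<le> K * L2_norm M f)}"

definition has_L2_deriv ::
    "'a measure \<Rightarrow> (('a \<Rightarrow> real) \<Rightarrow> real) \<Rightarrow> ('a \<Rightarrow> real) \<Rightarrow> (('a \<Rightarrow> real) \<Rightarrow> real) \<Rightarrow> bool" where
  "has_L2_deriv M J w F \<longleftrightarrow> F \<in> L2_dual M \<and>
     (\<forall>e>0. \<exists>d>0. \<forall>h\<in>L2 M. L2_norm M h < d \<longrightarrow>
        \<bar>J (\<lambda>x. w x + h x) - J w - F h\<bar> \<le> e * L2_norm M h)"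

definition L2_bilinear ::
    "'a measure \<Rightarrow> (('a \<Rightarrow> real) \<Rightarrow> ('a \<Rightarrow> real) \<Rightarrow> real) \<Rightarrow> bool" where
  "L2_bilinear M B \<longleftrightarrow>
     (\<forall>f\<in>L2 M. B f \<in> L2_dual M) \<and> (\<forall>g\<in>L2 M. (\<lambda>f. B f g) \<in> L2_dual M) \<and>
     (\<exists>K. \<forall>f\<in>L2 M. \<forall>g\<in>L2 M. \<bar>B f g\<bar> \<le> K * L2_norm M f * L2_norm M g)"

text \<open>
  \<open>J\<close> is differentiable near \<open>w\<close>, and its derivative \<open>DJ\<close>, as a map into the dual space with
  the operator norm, has derivative \<open>h \<mapsto> B h\<close> at \<open>w\<close>.
\<close>

definition has_L2_deriv2 :: "'a measure \<Rightarrow> (('a \<Rightarrow> real) \<Rightarrow> real) \<Rightarrow> ('a \<Rightarrow> real) \<Rightarrow>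
    (('a \<Rightarrow> real) \<Rightarrow> ('a \<Rightarrow> real) \<Rightarrow> real) \<Rightarrow> bool" where
  "has_L2_deriv2 M J w B \<longleftrightarrow> L2_bilinear M B \<and>
     (\<exists>DJ.
        (\<exists>r>0. \<forall>v\<in>L2 M. L2_norm M (\<lambda>x. v x - w x) < r \<longrightarrow> has_L2_deriv M J v (DJ v)) \<and>
        (\<forall>e>0. \<exists>d>0. \<forall>h\<in>L2 M. L2_norm M h < d \<longrightarrow>
           (\<forall>g\<in>L2 M. \<bar>DJ (\<lambda>x. w x + h x) g - DJ w g - B h g\<bar> \<le> e * L2_norm M h * L2_norm M g)))"

text \<open>
  The second derivative at \<open>w\<close>. If it exists, its values on \<open>L2 M \<times> L2 M\<close> are unique; only values
  at arguments outside \<open>L2 M\<close> depend on the choice.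
\<close>

definition L2_hess :: "'a measure \<Rightarrow> (('a \<Rightarrow> real) \<Rightarrow> real) \<Rightarrow> ('a \<Rightarrow> real) \<Rightarrow>
    ('a \<Rightarrow> real) \<Rightarrow> ('a \<Rightarrow> real) \<Rightarrow> real" where
  "L2_hess M J w = (SOME B. has_L2_deriv2 M J w B)"

end

theory Submission
  imports Defs
begin

text \<open>
  Write \<open>z = u\<^sub>x\<close> and \<open>y = u\<^sub>x\<^sub>t\<close>. As \<open>z\<close> is the primitive in time of \<open>y\<close>, the space-time integral of
  \<open>y z\<close> is nonnegative; with \<open>p = H\<^sub>v y + H\<^sub>e z\<close> this bounds \<open>z\<close> and \<open>y\<close> by \<open>p\<close> in \<open>L\<^sup>2\<close>, and testing the
  second equation with \<open>p\<close> bounds the state by \<open>\<psi>\<close>. Hence solutions are unique, \<open>G\<close> is linear and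
  bounded, and the Hessian of the quadratic functional \<open>j\<close> is the \<open>L\<^sup>2\<close> inner product of the states.
  Conversely, testing with a fixed \<open>q\<close> such that \<open>q(L) \<noteq> 0\<close> expresses \<open>\<psi>\<close> by \<open>y\<close> and \<open>p\<close>, so
  \<open>\<parallel>\<psi>\<parallel>\<^sub>2 \<le> K \<parallel>p\<parallel>\<^sub>2\<close>. A bound of the Hessian by \<open>L\<^sup>1\<close> norms would therefore
  give \<open>\<parallel>\<psi>\<parallel>\<^sub>2 \<le> K' \<parallel>\<psi>\<parallel>\<^sub>1\<close> for all \<open>\<psi>\<close>, which fails for indicators of short intervals.
\<close>

section \<open>Square integrable functions\<close>

text \<open>Weak solutions are tied together only by almost-everywhere statements. The time
  derivative is prescribed for \<open>u\<close>, not for its space derivative, and each test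
  function brings its own null set of times. The identity that makes \<open>z\<close> the primitive
  of \<open>y\<close> therefore has to be recovered from tested scalar functions of time, with the
  initial value read off from the continuous representative. The map \<open>G\<close> is merely some
  selection of weak solutions, so its linearity is a consequence of uniqueness and holds only up to
  null sets. Likewise \<open>L2_hess\<close> is chosen by \<open>SOME\<close>, so second derivatives
  have to be shown unique on \<open>L2\<close> before this one can be computed.

  The contradiction rests on \<delta> > 0: since \<open>Hv > 0\<close> and the cross term has a
  sign, p = Hv y + He z controls y itself. This yields the full L2 norm of \<psi> in the lower
  bound, a norm that the L1 norm cannot dominate. The Hessian of a quadratic functional does not
  depend on the base point, so the diagonal \<xi> = \<phi> decides the matter.\<close>

lemma L2_borel_measurable: "f \<in> L2 M \<Longrightarrow> f \<in> borel_measurable M"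
  by (simp add: L2_def)

lemma L2_integrable_power2: "f \<in> L2 M \<Longrightarrow> integrable M (\<lambda>x. (f x)\<^sup>2)"
  by (simp add: L2_def)

lemma L2_integrable_mult:
  assumes "f \<in> L2 M" "g \<in> L2 M"
  shows "integrable M (\<lambda>x. f x * g x)"
proof (rule Bochner_Integration.integrable_bound)
  show "integrable M (\<lambda>x. (f x)\<^sup>2 + (g x)\<^sup>2)"
    using assms by (simp add: L2_def)
  show "(\<lambda>x. f x * g x) \<in> borel_measurable M"
    using assms by (auto simp: L2_def)
  have "\<bar>a * b\<bar> \<le> \<bar>a\<^sup>2 + b\<^sup>2\<bar>" for a b :: real
  proof -
    have "2 * (\<bar>a\<bar> * \<bar>b\<bar>) \<le> a\<^sup>2 + b\<^sup>2"
      using sum_squares_bound[of "\<bar>a\<bar>" "\<bar>b\<bar>"] by simp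
    moreover have "0 \<le> \<bar>a\<bar> * \<bar>b\<bar>"
      by simp
    ultimately show ?thesis
      unfolding abs_mult by linarith
  qed
  then show "AE x in M. norm (f x * g x) \<le> norm ((f x)\<^sup>2 + (g x)\<^sup>2)"
    by simp
qed

lemma L2_scale: "f \<in> L2 M \<Longrightarrow> (\<lambda>x. a * f x) \<in> L2 M"
  by (auto simp: L2_def power_mult_distrib)

lemma L2_add:
  assumes "f \<in> L2 M" "g \<in> L2 M"
  shows "(\<lambda>x. f x + g x) \<in> L2 M"
  using assms L2_integrable_mult[OF assms]
  by (auto simp: L2_def power2_sum mult.assoc)

lemma L2_lincomb:
  "f \<in> L2 M \<Longrightarrow> g \<in> L2 M \<Longrightarrow> (\<lambda>x. a * f x + b * g x) \<in> L2 M"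
  by (intro L2_add L2_scale)

lemma L2_diff: "f \<in> L2 M \<Longrightarrow> g \<in> L2 M \<Longrightarrow> (\<lambda>x. f x - g x) \<in> L2 M"
  using L2_lincomb[of f M g 1 "-1"] by simp

lemma L2_norm_nonneg: "0 \<le> L2_norm M f"
  by (simp add: L2_norm_def)

lemma L2_norm_power2: "(L2_norm M f)\<^sup>2 = (LINT x|M. (f x)\<^sup>2)"
  by (simp add: L2_norm_def)

lemma L2_norm_scale: "L2_norm M (\<lambda>x. a * f x) = \<bar>a\<bar> * L2_norm M f"
  by (simp add: L2_norm_def power_mult_distrib real_sqrt_mult)

text \<open>Discriminant argument: the quadratic form in (a, b) given by the squared norm of a f + b
  g is nonnegative, and its value at (-B, A) is A (A C - B^2).\<close>

lemma L2_Cauchy_Schwarz_power2: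
  assumes "f \<in> L2 M" "g \<in> L2 M"
  shows "(LINT x|M. f x * g x)\<^sup>2 \<le> (LINT x|M. (f x)\<^sup>2) * (LINT x|M. (g x)\<^sup>2)"
proof -
  define A B C where "A = (LINT x|M. (f x)\<^sup>2)" and "B = (LINT x|M. f x * g x)"
    and "C = (LINT x|M. (g x)\<^sup>2)"
  have pos: "0 \<le> a\<^sup>2 * A + 2 * a * b * B + b\<^sup>2 * C" for a b
  proof -
    have "0 \<le> (LINT x|M. (a * f x + b * g x)\<^sup>2)"
      by simp
    also have "\<dots> = (LINT x|M. a\<^sup>2 * (f x)\<^sup>2 + 2 * a * b * (f x * g x) + b\<^sup>2 * (g x)\<^sup>2)"
      by (intro Bochner_Integration.integral_cong refl) (simp add: power2_eq_square algebra_simps)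
    also have "\<dots> = a\<^sup>2 * A + 2 * a * b * B + b\<^sup>2 * C"
      using assms L2_integrable_mult[OF assms]
      by (simp add: L2_def A_def B_def C_def)
    finally show ?thesis .
  qed
  have A0: "0 \<le> A" "0 \<le> C"
    by (simp_all add: A_def C_def)
  have "B\<^sup>2 \<le> A * C"
  proof (cases "A = 0")
    case True
    \<comment> \<open>With A = 0 the form is 2 a b B + b^2 C. The choice a = -(C + 1), b = B turns
      it into -(C + 2) B^2, which forces B = 0.\<close>
    have "0 \<le> 2 * (- (C + 1)) * B * B + B\<^sup>2 * C"
      using pos[of "- (C + 1)" B] True by (simp add: algebra_simps power2_eq_square)
    then have "(C + 2) * B\<^sup>2 \<le> 0"
      by (simp add: algebra_simps power2_eq_square)
    then have "B\<^sup>2 \<le> 0"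
      using A0 by (simp add: mult_le_0_iff)
    then show ?thesis
      using True by simp
  next
    case False
    have "0 \<le> A * (A * C - B\<^sup>2)"
      using pos[of "- B" A] by (simp add: algebra_simps power2_eq_square)
    then show ?thesis
      using False A0 by (simp add: zero_le_mult_iff)
  qed
  then show ?thesis
    by (simp add: A_def B_def C_def)
qed

lemma L2_Cauchy_Schwarz:
  assumes "f \<in> L2 M" "g \<in> L2 M"
  shows "\<bar>LINT x|M. f x * g x\<bar> \<le> L2_norm M f * L2_norm M g"
  using real_sqrt_le_mono[OF L2_Cauchy_Schwarz_power2[OF assms]]
  by (simp add: L2_norm_def real_sqrt_mult)

lemma L2_const: "finite_measure M \<Longrightarrow> (\<lambda>x. c) \<in> L2 M"
  by (simp add: L2_def finite_measure.integrable_const)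

lemma L2_integrable: "finite_measure M \<Longrightarrow> f \<in> L2 M \<Longrightarrow> integrable M f"
  using L2_integrable_mult[OF L2_const[of M 1], of f] by simp

lemma L2_bounded:
  assumes "finite_measure M" "f \<in> borel_measurable M" "\<And>x. x \<in> space M \<Longrightarrow> \<bar>f x\<bar> \<le> c"
  shows "f \<in> L2 M"
proof -
  have "(f x)\<^sup>2 \<le> c\<^sup>2" if "x \<in> space M" for x
    using assms(3)[OF that] by (metis abs_ge_zero power2_abs power_mono)
  then have "integrable M (\<lambda>x. (f x)\<^sup>2)"
    using assms by (intro finite_measure.integrable_const_bound[where B="c\<^sup>2"]) auto
  then show ?thesis
    using assms by (simp add: L2_def)
qed

section \<open>Derivatives of quadratic functionals\<close>

lemma L2_dual_scale:
  assumes "F \<in> L2_dual M" "f \<in> L2 M"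
  shows "F (\<lambda>x. s * f x) = s * F f"
proof -
  have "F (\<lambda>x. s * f x + 0 * f x) = s * F f + 0 * F f"
    using assms unfolding L2_dual_def by blast
  then show ?thesis by simp
qed

lemma L2_dual_add:
  assumes "F \<in> L2_dual M" "f \<in> L2 M" "g \<in> L2 M"
  shows "F (\<lambda>x. f x + g x) = F f + F g"
proof -
  have "F (\<lambda>x. 1 * f x + 1 * g x) = 1 * F f + 1 * F g"
    using assms unfolding L2_dual_def by blast
  then show ?thesis by simp
qed

lemma L2_dual_add_fun:
  assumes "F \<in> L2_dual M" "F' \<in> L2_dual M"
  shows "(\<lambda>f. F f + F' f) \<in> L2_dual M"
proof -
  obtain K K' where "\<forall>f\<in>L2 M. \<bar>F f\<bar> \<le> K * L2_norm M f" "\<forall>f\<in>L2 M. \<bar>F' f\<bar> \<le> K' * L2_norm M f"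
    using assms unfolding L2_dual_def by blast
  then have "\<forall>f\<in>L2 M. \<bar>F f + F' f\<bar> \<le> (K + K') * L2_norm M f"
    by (auto simp: distrib_right intro!: order_trans[OF abs_triangle_ineq] add_mono)
  then show ?thesis
    using assms unfolding L2_dual_def by (auto simp: distrib_left)
qed

lemma small_scaling:
  assumes "d > 0"
  obtains s where "s > 0" "L2_norm M (\<lambda>x. s * h x) < d"
proof
  \<comment> \<open>The summand 1 keeps the denominator positive when the norm of \<open>h\<close>
    is zero.\<close>
  define s where "s = d / (L2_norm M h + 1)"
  have *: "L2_norm M h + 1 > 0"
    using L2_norm_nonneg[of M h] by linarith
  then show s: "s > 0"
    using assms by (simp add: s_def)
  have "s * L2_norm M h < s * (L2_norm M h + 1)"
    using s by simp
  also have "\<dots> = d"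
    using * by (simp add: s_def)
  finally show "L2_norm M (\<lambda>x. s * h x) < d"
    using s by (simp add: L2_norm_scale)
qed

text \<open>Both sides of the little-o estimate are homogeneous of degree one, so a bound valid for
  small multiples of \<open>h\<close> is valid for \<open>h\<close> itself, with every
  \<open>e\<close>. The factor \<open>c\<close> is 1 for first derivatives and the norm of the
  second argument for second derivatives.\<close>

lemma homogeneous_little_o_zero:
  assumes "h \<in> L2 M" and c: "c \<ge> 0"
    and hom: "\<And>s. s > 0 \<Longrightarrow> D (\<lambda>x. s * h x) = s * D h"
    and small: "\<And>e. e > 0 \<Longrightarrow> \<exists>d>0. \<forall>h\<in>L2 M. L2_norm M h < d \<longrightarrow> \<bar>D h\<bar> \<le> e * L2_norm M h * c"
  shows "D h = (0::real)"
proof -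
  have "\<bar>D h\<bar> \<le> e * L2_norm M h * c" if e: "e > 0" for e
  proof -
    obtain d where "d > 0"
      and d: "\<forall>h\<in>L2 M. L2_norm M h < d \<longrightarrow> \<bar>D h\<bar> \<le> e * L2_norm M h * c"
      using small[OF e] by blast
    obtain s where s: "s > 0" "L2_norm M (\<lambda>x. s * h x) < d"
      using small_scaling[OF \<open>d > 0\<close>] .
    then have "\<bar>D (\<lambda>x. s * h x)\<bar> \<le> e * L2_norm M (\<lambda>x. s * h x) * c"
      using d L2_scale[OF assms(1)] by blast
    then have "s * \<bar>D h\<bar> \<le> s * (e * L2_norm M h * c)"
      using s by (simp add: hom L2_norm_scale abs_mult algebra_simps)
    then show ?thesis
      using s by simp
  qed
  note bound = this
  show ?thesis
  proof (rule ccontr)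
    assume nz: "D h \<noteq> 0"
    \<comment> \<open>Taking \<open>e\<close> as the modulus of \<open>D h\<close> divided by
      \<open>q\<close> contradicts the bound, because \<open>q\<close> strictly exceeds the factor
      that multiplies \<open>e\<close>.\<close>
    define q where "q = L2_norm M h * c + 1"
    have q: "q > 0"
      using c L2_norm_nonneg[of M h] by (simp add: q_def add_nonneg_pos)
    have "\<bar>D h\<bar> \<le> \<bar>D h\<bar> / q * (L2_norm M h * c)"
      using bound[of "\<bar>D h\<bar> / q"] nz q by (simp add: mult.assoc)
    also have "\<dots> < \<bar>D h\<bar> / q * q"
      using nz q by (intro mult_strict_left_mono) (auto simp: q_def)
    finally show False
      using q by simp
  qed
qed

text \<open>The difference of two derivatives is homogeneous and little-o of the increment, as both
  approximate the same increment of \<open>J\<close>.\<close>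

lemma has_L2_deriv_unique:
  assumes "has_L2_deriv M J w F" "has_L2_deriv M J w F'" "h \<in> L2 M"
  shows "F h = F' h"
proof -
  have dual: "F \<in> L2_dual M" "F' \<in> L2_dual M"
    using assms unfolding has_L2_deriv_def by auto
  have "F h - F' h = 0"
  proof (rule homogeneous_little_o_zero[where D = "\<lambda>h. F h - F' h" and c = 1])
    fix e :: real assume "e > 0"
    then have e2: "e / 2 > 0" by simp
    obtain d1 where d1: "d1 > 0" "\<forall>h\<in>L2 M. L2_norm M h < d1 \<longrightarrow>
        \<bar>J (\<lambda>x. w x + h x) - J w - F h\<bar> \<le> e / 2 * L2_norm M h"
      using assms(1) e2 unfolding has_L2_deriv_def by blast
    obtain d2 where d2: "d2 > 0" "\<forall>h\<in>L2 M. L2_norm M h < d2 \<longrightarrow>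
        \<bar>J (\<lambda>x. w x + h x) - J w - F' h\<bar> \<le> e / 2 * L2_norm M h"
      using assms(2) e2 unfolding has_L2_deriv_def by blast
    show "\<exists>d>0. \<forall>h\<in>L2 M. L2_norm M h < d \<longrightarrow> \<bar>F h - F' h\<bar> \<le> e * L2_norm M h * 1"
    proof (intro exI[of _ "min d1 d2"] conjI ballI impI)
      fix h assume h: "h \<in> L2 M" "L2_norm M h < min d1 d2"
      then have "\<bar>J (\<lambda>x. w x + h x) - J w - F h\<bar> \<le> e / 2 * L2_norm M h"
        "\<bar>J (\<lambda>x. w x + h x) - J w - F' h\<bar> \<le> e / 2 * L2_norm M h"
        using d1 d2 by auto
      then show "\<bar>F h - F' h\<bar> \<le> e * L2_norm M h * 1"
        by linarith
    qed (use d1 d2 in auto)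
  qed (use assms(3) dual in \<open>auto simp: L2_dual_scale algebra_simps\<close>)
  then show ?thesis by simp
qed

text \<open>By bilinearity and symmetry the remainder of the first-order expansion is exactly half
  of \<open>B h h\<close>, which is bounded by a multiple of the squared norm.\<close>

lemma has_L2_deriv_quadratic:
  assumes B: "L2_bilinear M B" and sym: "\<And>f g. f \<in> L2 M \<Longrightarrow> g \<in> L2 M \<Longrightarrow> B f g = B g f"
    and l: "l \<in> L2_dual M"
    and J: "\<And>v. v \<in> L2 M \<Longrightarrow> J v = c + l v + 1 / 2 * B v v"
    and v: "v \<in> L2 M"
  shows "has_L2_deriv M J v (\<lambda>g. l g + B v g)"
proof -
  have BD: "B f \<in> L2_dual M" "(\<lambda>g. B g f) \<in> L2_dual M" if "f \<in> L2 M" for f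
    using B that unfolding L2_bilinear_def by auto
  obtain K where K: "\<forall>f\<in>L2 M. \<forall>g\<in>L2 M. \<bar>B f g\<bar> \<le> K * L2_norm M f * L2_norm M g"
    using B unfolding L2_bilinear_def by blast
  have rem: "J (\<lambda>x. v x + h x) - J v - (l h + B v h) = 1 / 2 * B h h" if h: "h \<in> L2 M" for h
  proof -
    have vh: "(\<lambda>x. v x + h x) \<in> L2 M"
      using L2_add v h by blast
    have "B (\<lambda>x. v x + h x) (\<lambda>x. v x + h x) = B v v + B v h + (B h v + B h h)"
      using L2_dual_add[OF BD(2)[OF vh] v h] L2_dual_add[OF BD(1)[OF v] v h]
        L2_dual_add[OF BD(1)[OF h] v h] by simp
    then show ?thesis
      unfolding J[OF vh] J[OF v] L2_dual_add[OF l v h] sym[OF h v] by (simp add: field_simps)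
  qed
  \<comment> \<open>The bound \<open>K\<close> of the bilinear form carries no sign, so the radius
    uses its modulus plus 1.\<close>
  have "\<exists>d>0. \<forall>h\<in>L2 M. L2_norm M h < d \<longrightarrow>
      \<bar>J (\<lambda>x. v x + h x) - J v - (l h + B v h)\<bar> \<le> e * L2_norm M h" if e: "e > 0" for e
  proof (intro exI[of _ "e / (\<bar>K\<bar> + 1)"] conjI ballI impI)
    show "0 < e / (\<bar>K\<bar> + 1)"
      using e by (simp add: add_nonneg_pos)
    fix h assume h: "h \<in> L2 M" "L2_norm M h < e / (\<bar>K\<bar> + 1)"
    have n: "0 \<le> L2_norm M h"
      by (rule L2_norm_nonneg)
    have "\<bar>B h h\<bar> \<le> K * L2_norm M h * L2_norm M h"
      using K h by blast
    also have "\<dots> \<le> (\<bar>K\<bar> + 1) * L2_norm M h * L2_norm M h"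
      using n by (intro mult_right_mono) auto
    also have "\<dots> \<le> e * L2_norm M h"
      using h n by (intro mult_right_mono)
        (auto simp: field_simps add_nonneg_pos pos_less_divide_eq)
    finally show "\<bar>J (\<lambda>x. v x + h x) - J v - (l h + B v h)\<bar> \<le> e * L2_norm M h"
      unfolding rem[OF h(1)] by simp
  qed
  then show ?thesis
    unfolding has_L2_deriv_def using L2_dual_add_fun[OF l BD(1)[OF v]] by blast
qed

text \<open>Exhibiting \<open>B\<close> as a second derivative does not evaluate the
  \<open>SOME\<close> in \<open>L2_hess\<close>. It only shows that the chosen object is a second
  derivative too; the rest of the argument compares the two.\<close>

lemma L2_hess_quadratic:
  assumes B: "L2_bilinear M B" and sym: "\<And>f g. f \<in> L2 M \<Longrightarrow> g \<in> L2 M \<Longrightarrow> B f g = B g f"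
    and l: "l \<in> L2_dual M"
    and J: "\<And>v. v \<in> L2 M \<Longrightarrow> J v = c + l v + 1 / 2 * B v v"
    and w: "w \<in> L2 M" and "\<xi> \<in> L2 M" "\<phi> \<in> L2 M"
  shows "L2_hess M J w \<xi> \<phi> = B \<xi> \<phi>"
proof -
  have BD: "B f \<in> L2_dual M" "(\<lambda>g. B g f) \<in> L2_dual M" if "f \<in> L2 M" for f
    using B that unfolding L2_bilinear_def by auto
  define DJ where "DJ = (\<lambda>v g. l g + B v g)"
  have deriv: "has_L2_deriv M J v (DJ v)" if "v \<in> L2 M" for v
    unfolding DJ_def using that by (intro has_L2_deriv_quadratic[where c = c] B sym l J)
  have DJ_diff: "DJ (\<lambda>x. w x + h x) g - DJ w g = B h g" if "h \<in> L2 M" "g \<in> L2 M" for h g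
    using L2_dual_add[OF BD(2)[OF that(2)] w that(1)] by (simp add: DJ_def)
  have "has_L2_deriv2 M J w B"
    unfolding has_L2_deriv2_def
  proof (intro conjI B exI[of _ DJ])
    show "\<exists>r>0. \<forall>v\<in>L2 M. L2_norm M (\<lambda>x. v x - w x) < r \<longrightarrow> has_L2_deriv M J v (DJ v)"
      by (intro exI[of _ 1]) (auto intro!: deriv)
    show "\<forall>e>0. \<exists>d>0. \<forall>h\<in>L2 M. L2_norm M h < d \<longrightarrow> (\<forall>g\<in>L2 M.
      \<bar>DJ (\<lambda>x. w x + h x) g - DJ w g - B h g\<bar> \<le> e * L2_norm M h * L2_norm M g)"
      by (intro allI impI exI[of _ 1])
        (auto simp: DJ_diff intro!: mult_nonneg_nonneg L2_norm_nonneg)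
  qed
  then have "has_L2_deriv2 M J w (L2_hess M J w)"
    unfolding L2_hess_def by (rule someI[of "has_L2_deriv2 M J w"])
  then obtain DJ' r where H: "L2_bilinear M (L2_hess M J w)" and "r > 0"
    and r: "\<forall>v\<in>L2 M. L2_norm M (\<lambda>x. v x - w x) < r \<longrightarrow> has_L2_deriv M J v (DJ' v)"
    and small: "\<forall>e>0. \<exists>d>0. \<forall>h\<in>L2 M. L2_norm M h < d \<longrightarrow> (\<forall>g\<in>L2 M.
      \<bar>DJ' (\<lambda>x. w x + h x) g - DJ' w g - L2_hess M J w h g\<bar> \<le> e * L2_norm M h * L2_norm M g)"
    unfolding has_L2_deriv2_def by blast
  \<comment> \<open>The chosen second derivative comes with its own first derivative
    \<open>DJ'\<close>. Uniqueness identifies it with \<open>DJ\<close>, but only within distance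
    \<open>r\<close> of \<open>w\<close>, which explains the radius \<open>min d r\<close>
    below.\<close>
  have DJ': "DJ' v g = DJ v g"
    if "v \<in> L2 M" "L2_norm M (\<lambda>x. v x - w x) < r" "g \<in> L2 M" for v g
    using has_L2_deriv_unique[OF _ deriv[OF that(1)] that(3)] r that by blast
  have HD: "(\<lambda>f. L2_hess M J w f \<phi>) \<in> L2_dual M"
    using H assms(7) unfolding L2_bilinear_def by auto
  have "L2_hess M J w \<xi> \<phi> - B \<xi> \<phi> = 0"
  proof (rule homogeneous_little_o_zero[where D = "\<lambda>f. L2_hess M J w f \<phi> - B f \<phi>"
        and c = "L2_norm M \<phi>"])
    fix e :: real assume "e > 0"
    then obtain d where "d > 0" and d: "\<forall>h\<in>L2 M. L2_norm M h < d \<longrightarrow> (\<forall>g\<in>L2 M.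
      \<bar>DJ' (\<lambda>x. w x + h x) g - DJ' w g - L2_hess M J w h g\<bar> \<le> e * L2_norm M h * L2_norm M g)"
      using small by blast
    show "\<exists>d>0. \<forall>h\<in>L2 M. L2_norm M h < d \<longrightarrow>
        \<bar>L2_hess M J w h \<phi> - B h \<phi>\<bar> \<le> e * L2_norm M h * L2_norm M \<phi>"
    proof (intro exI[of _ "min d r"] conjI ballI impI)
      fix h assume h: "h \<in> L2 M" "L2_norm M h < min d r"
      have "DJ' (\<lambda>x. w x + h x) \<phi> = DJ (\<lambda>x. w x + h x) \<phi>" "DJ' w \<phi> = DJ w \<phi>"
        using h w \<open>r > 0\<close> assms(7) by (auto intro!: DJ' L2_add simp: L2_norm_def)
      then have "DJ' (\<lambda>x. w x + h x) \<phi> - DJ' w \<phi> = B h \<phi>"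
        using DJ_diff[OF h(1) assms(7)] by simp
      moreover have "\<bar>DJ' (\<lambda>x. w x + h x) \<phi> - DJ' w \<phi> - L2_hess M J w h \<phi>\<bar>
          \<le> e * L2_norm M h * L2_norm M \<phi>"
        using d h assms(7) by auto
      ultimately show "\<bar>L2_hess M J w h \<phi> - B h \<phi>\<bar> \<le> e * L2_norm M h * L2_norm M \<phi>"
        by (simp add: abs_minus_commute)
    qed (use \<open>d > 0\<close> \<open>r > 0\<close> in auto)
  qed (use assms in \<open>auto simp: L2_dual_scale[OF HD] L2_dual_scale[OF BD(2)] L2_norm_nonneg
        algebra_simps\<close>)
  then show ?thesis by simp
qed

section \<open>Test functions and primitives on an interval\<close>

lemma finite_measure_leb: "finite_measure (leb b)"
  by (rule finite_measureI) (cases "0 \<le> b"; simp add: emeasure_restrict_space space_restrict_space)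

interpretation leb: finite_measure "leb b" for b
  by (rule finite_measure_leb)

interpretation lebs: pair_sigma_finite "leb a" "leb b" for a b
  by standard

lemma space_leb [simp]: "space (leb b) = {0<..<b}"
  by (simp add: space_restrict_space)

lemma measurable_ident_leb [measurable]: "(\<lambda>x. x) \<in> borel_measurable (leb b)"
  by (rule measurable_restrict_space1) simp

lemma measurable_fst_leb [measurable]: "fst \<in> borel_measurable (leb a \<Otimes>\<^sub>M M)"
  using measurable_compose[OF measurable_fst measurable_ident_leb] by simp

lemma measurable_snd_leb [measurable]: "snd \<in> borel_measurable (M \<Otimes>\<^sub>M leb a)"
  using measurable_compose[OF measurable_snd measurable_ident_leb] by simp

lemma L2_leb_integrable: "f \<in> L2 (leb b) \<Longrightarrow> integrable (leb b) f"
  by (rule L2_integrable[OF finite_measure_leb])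

lemma continuous_bounded_interval:
  fixes \<phi> :: "real \<Rightarrow> real"
  assumes "continuous_on {0..b} \<phi>"
  obtains K where "K \<ge> 0" "\<And>x. x \<in> {0..b} \<Longrightarrow> \<bar>\<phi> x\<bar> \<le> K"
proof -
  have "bounded (\<phi> ` {0..b})"
    using assms by (intro compact_imp_bounded compact_continuous_image) auto
  then obtain K where "\<forall>x\<in>{0..b}. \<bar>\<phi> x\<bar> \<le> K"
    unfolding bounded_iff by auto
  then have "\<bar>\<phi> x\<bar> \<le> max 0 K" if "x \<in> {0..b}" for x
    using that by fastforce
  then show ?thesis
    by (intro that[of "max 0 K"]) auto
qed

lemma continuous_measurable_leb:
  fixes \<phi> :: "real \<Rightarrow> real"
  assumes "continuous_on {0..b} \<phi>"
  shows "\<phi> \<in> borel_measurable (leb b)"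
proof -
  have "\<phi> \<in> borel_measurable (restrict_space borel {0<..<b})"
    by (intro borel_measurable_continuous_on_restrict continuous_on_subset[OF assms]) auto
  moreover have "sets (leb b) = sets (restrict_space borel {0<..<b})"
    by (intro sets_restrict_space_cong) simp
  ultimately show ?thesis
    using measurable_cong_sets by blast
qed

lemma continuous_L2:
  fixes \<phi> :: "real \<Rightarrow> real"
  assumes "continuous_on {0..b} \<phi>"
  shows "\<phi> \<in> L2 (leb b)"
proof -
  obtain K where "\<And>x. x \<in> {0..b} \<Longrightarrow> \<bar>\<phi> x\<bar> \<le> K"
    using continuous_bounded_interval[OF assms] by blast
  then show ?thesis
    by (intro L2_bounded[where c = K] finite_measure_leb continuous_measurable_leb assms) auto
qed

lemma integrable_mult_continuous:
  fixes \<phi> f :: "real \<Rightarrow> real"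
  assumes "integrable (leb b) f" "continuous_on {0..b} \<phi>"
  shows "integrable (leb b) (\<lambda>x. f x * \<phi> x)"
proof -
  obtain K where K: "\<And>x. x \<in> {0..b} \<Longrightarrow> \<bar>\<phi> x\<bar> \<le> K"
    using continuous_bounded_interval[OF assms(2)] by blast
  have [measurable]: "\<phi> \<in> borel_measurable (leb b)" "f \<in> borel_measurable (leb b)"
    using assms continuous_measurable_leb by auto
  show ?thesis
  proof (rule Bochner_Integration.integrable_bound[of _ "\<lambda>x. K * f x"])
    have "\<bar>f x * \<phi> x\<bar> \<le> \<bar>K * f x\<bar>" if "x \<in> {0<..<b}" for x
    proof -
      have "\<bar>f x\<bar> * \<bar>\<phi> x\<bar> \<le> \<bar>f x\<bar> * K"
        using K[of x] that by (intro mult_left_mono) auto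
      moreover have "K \<ge> 0"
        using K[of x] that abs_ge_zero[of "\<phi> x"] by auto
      ultimately show ?thesis
        by (simp add: abs_mult mult.commute)
    qed
    then show "AE x in leb b. norm (f x * \<phi> x) \<le> norm (K * f x)"
      by (intro AE_I2) simp
  qed (use assms in auto)
qed

lemma test_fun_continuous:
  assumes "test_fun b \<phi>"
  shows "continuous_on A \<phi>" "continuous_on A (deriv \<phi>)"
proof -
  have "isCont \<phi> x" for x
    using assms unfolding test_fun_def
    by (intro differentiable_imp_continuous_within) auto
  then show "continuous_on A \<phi>"
    by (simp add: continuous_at_imp_continuous_on)
  show "continuous_on A (deriv \<phi>)"
    using assms unfolding test_fun_def by (auto intro: continuous_on_subset)
qed

lemma test_fun_L2:
  assumes "test_fun b \<phi>"
  shows "\<phi> \<in> L2 (leb b)" "deriv \<phi> \<in> L2 (leb b)"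
  using test_fun_continuous[OF assms] by (auto intro: continuous_L2)

lemma test_fun_zero:
  assumes "test_fun b \<phi>" "x \<le> 0 \<or> b \<le> x"
  shows "\<phi> x = 0"
  using assms unfolding test_fun_def by force

lemma test_fun_deriv:
  assumes "test_fun b \<phi>"
  shows "(\<phi> has_real_derivative deriv \<phi> x) (at x)"
  using assms unfolding test_fun_def
  by (simp add: DERIV_deriv_iff_real_differentiable)

text \<open>Otherwise \<open>k\<close> would differ from \<open>m\<close> on a whole interval next
  to \<open>a\<close>, which has positive measure. This is how almost-everywhere identities are
  evaluated at a single point, such as the initial time or an end of the interval.\<close>

lemma AE_leb_limit:
  fixes k :: "real \<Rightarrow> real"
  assumes "b > 0" "a \<in> {0..b}" and AE: "AE t in leb b. k t = m"
    and lim: "(k \<longlongrightarrow> l) (at a within {0..b})"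
  shows "l = m"
proof (rule ccontr)
  assume "l \<noteq> m"
  then have "eventually (\<lambda>t. k t \<noteq> m) (at a within {0..b})"
    using tendsto_imp_eventually_ne[OF lim] by blast
  then obtain d where d: "d > 0" "\<And>t. t \<in> {0..b} \<Longrightarrow> t \<noteq> a \<Longrightarrow> dist t a < d \<Longrightarrow> k t \<noteq> m"
    unfolding eventually_at by blast
  \<comment> \<open>The interval lies on one side of \<open>a\<close>, since a limit says nothing
    about the value at \<open>a\<close>: to the right if \<open>a < b\<close>, to the left if
    \<open>a = b\<close>.\<close>
  have "\<exists>c e. 0 \<le> c \<and> c < e \<and> e \<le> b \<and> a - d \<le> c \<and> e \<le> a + d \<and> (e \<le> a \<or> a \<le> c)"
  proof (cases "a < b")
    case True
    then show ?thesis
      using assms d by (intro exI[of _ a] exI[of _ "min b (a + d)"]) auto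
  next
    case False
    then show ?thesis
      using assms d by (intro exI[of _ "max 0 (a - d)"] exI[of _ a]) auto
  qed
  then obtain c e where ce: "0 \<le> c" "c < e" "e \<le> b" "a - d \<le> c" "e \<le> a + d" "e \<le> a \<or> a \<le> c"
    by blast
  have "AE t in lborel. t \<in> {0<..<b} \<longrightarrow> k t = m"
    using AE by (simp add: AE_restrict_space_iff)
  then have "AE t in lborel. t \<notin> {c<..<e}"
  proof eventually_elim
    case (elim t)
    show ?case
    proof
      assume "t \<in> {c<..<e}"
      then show False
        using elim ce d(2)[of t] by (auto simp: dist_real_def)
    qed
  qed
  then have "emeasure lborel {c<..<e} = 0"
    by (subst (asm) AE_iff_measurable[of "{c<..<e}"]) auto
  then show False
    using ce by simp
qed

section \<open>Primitives of integrable functions and integration by parts\<close>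

text \<open>The upper limit sits in the integrand while the measure stays fixed, so that dominated
  convergence in \<open>x\<close> and Fubini on the square apply directly. The function is 0 to the
  left of 0 and constant to the right of \<open>b\<close>.\<close>

definition prim :: "real \<Rightarrow> (real \<Rightarrow> real) \<Rightarrow> real \<Rightarrow> real" where
  "prim b g x = (LINT s|leb b. (if s < x then g s else 0))"

lemma integrable_if_less:
  fixes g :: "real \<Rightarrow> real"
  assumes "integrable (leb b) g"
  shows "integrable (leb b) (\<lambda>s. if s < x then g s else 0)"
proof (rule Bochner_Integration.integrable_bound[OF assms])
  have [measurable]: "g \<in> borel_measurable (leb b)"
    using assms by auto
  show "(\<lambda>s. if s < x then g s else 0) \<in> borel_measurable (leb b)"
    by measurable
qed auto

lemma prim_lincomb:
  assumes "integrable (leb b) f" "integrable (leb b) g"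
  shows "prim b (\<lambda>s. c * f s + d * g s) x = c * prim b f x + d * prim b g x"
proof -
  have "prim b (\<lambda>s. c * f s + d * g s) x =
      (LINT s|leb b. c * (if s < x then f s else 0) + d * (if s < x then g s else 0))"
    unfolding prim_def by (intro Bochner_Integration.integral_cong) auto
  then show ?thesis
    using integrable_if_less[OF assms(1), of x] integrable_if_less[OF assms(2), of x]
    by (simp add: prim_def)
qed

lemma prim_0: "prim b g 0 = 0"
proof -
  have "prim b g 0 = (LINT s|leb b. 0)"
    unfolding prim_def by (intro Bochner_Integration.integral_cong) auto
  then show ?thesis by simp
qed

lemma prim_end: "prim b g b = (LINT s|leb b. g s)"
  unfolding prim_def by (intro Bochner_Integration.integral_cong) auto

lemma abs_prim_le:
  assumes "integrable (leb b) g"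
  shows "\<bar>prim b g x\<bar> \<le> (LINT s|leb b. \<bar>g s\<bar>)"
proof -
  have "\<bar>prim b g x\<bar> \<le> (LINT s|leb b. \<bar>if s < x then g s else 0\<bar>)"
    unfolding prim_def by (rule integral_abs_bound)
  also have "\<dots> \<le> (LINT s|leb b. \<bar>g s\<bar>)"
    using assms integrable_if_less[OF assms, of x] by (intro integral_mono) auto
  finally show ?thesis .
qed

text \<open>Dominated convergence with the majorant given by the modulus of \<open>g\<close>: the
  cut-off integrands converge at every \<open>s\<close> except possibly
  \<open>s = x\<close>.\<close>

lemma continuous_on_prim:
  assumes "integrable (leb b) g"
  shows "continuous_on A (prim b g)"
proof -
  have [measurable]: "g \<in> borel_measurable (leb b)"
    using assms by auto
  have "isCont (prim b g) x" for x
    unfolding continuous_at_sequentially comp_def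
  proof (intro allI impI)
    fix X assume X: "X \<longlonglongrightarrow> x"
    show "(\<lambda>n. prim b g (X n)) \<longlonglongrightarrow> prim b g x"
      unfolding prim_def
    proof (rule integral_dominated_convergence[where w = "\<lambda>s. \<bar>g s\<bar>"])
      have "AE s in lborel. s \<noteq> x"
        by (rule AE_lborel_singleton)
      then have "AE s in leb b. s \<noteq> x"
        by (subst AE_restrict_space_iff) auto
      then show "AE s in leb b. (\<lambda>n. if s < X n then g s else 0) \<longlonglongrightarrow> (if s < x then g s else 0)"
      proof eventually_elim
        case (elim s)
        then consider "s < x" | "s > x" by linarith
        then show ?case
        proof cases
          case 1
          have "eventually (\<lambda>n. s < X n) sequentially"
            using X 1 by (rule order_tendstoD)
          then have "eventually (\<lambda>n. (if s < X n then g s else 0) = (if s < x then g s else 0))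
              sequentially"
            by eventually_elim (use 1 in auto)
          then show ?thesis
            by (rule tendsto_eventually)
        next
          case 2
          have "eventually (\<lambda>n. s > X n) sequentially"
            using X 2 by (rule order_tendstoD)
          then have "eventually (\<lambda>n. (if s < X n then g s else 0) = (if s < x then g s else 0))
              sequentially"
            by eventually_elim (use 2 in auto)
          then show ?thesis
            by (rule tendsto_eventually)
        qed
      qed
    qed (use assms in auto)
  qed
  then show ?thesis
    by (simp add: continuous_at_imp_continuous_on)
qed

lemma integral_deriv_leb:
  assumes der: "\<And>x. (\<phi> has_real_derivative \<phi>' x) (at x)" and cont: "continuous_on UNIV \<phi>'"
    and s: "0 \<le> s" "s \<le> b"
  shows "(LINT x|leb b. (if s < x then \<phi>' x else 0)) = \<phi> b - \<phi> s"
proof -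
  have "(LINT x|leb b. (if s < x then \<phi>' x else 0)) =
      (LINT x|lborel. indicator {0<..<b} x *\<^sub>R (if s < x then \<phi>' x else 0))"
    by (rule integral_restrict_space) simp
  also have "\<dots> = (LINT x|lborel. indicator {s..b} x *\<^sub>R \<phi>' x)"
  proof (rule integral_cong_AE)
    note [measurable del] = measurable_ident_leb
    have [measurable]: "\<phi>' \<in> borel_measurable borel"
      using cont by (rule borel_measurable_continuous_onI)
    show "(\<lambda>x. indicator {0<..<b} x *\<^sub>R (if s < x then \<phi>' x else 0)) \<in> borel_measurable lborel"
      "(\<lambda>x. indicator {s..b} x *\<^sub>R \<phi>' x) \<in> borel_measurable lborel"
      by measurable
    have "AE x in lborel. x \<noteq> s" "AE x in lborel. x \<noteq> b"
      by (rule AE_lborel_singleton)+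
    then show "AE x in lborel. indicator {0<..<b} x *\<^sub>R (if s < x then \<phi>' x else 0) =
        indicator {s..b} x *\<^sub>R \<phi>' x"
      by eventually_elim (use s in \<open>auto simp: indicator_def\<close>)
  qed
  also have "\<dots> = \<phi> b - \<phi> s"
    using s der cont
    by (intro integral_FTC_Icc)
      (auto intro: has_vector_derivative_at_within continuous_on_subset
        simp: has_real_derivative_iff_has_vector_derivative)
  finally show ?thesis .
qed

lemma integrable_pair_mult:
  fixes f g :: "real \<Rightarrow> real"
  assumes "integrable (leb a) f" "integrable (leb b) g"
  shows "integrable (leb a \<Otimes>\<^sub>M leb b) (\<lambda>(x, y). f x * g y)"
proof (rule lebs.Fubini_integrable)
  have [measurable]: "f \<in> borel_measurable (leb a)" "g \<in> borel_measurable (leb b)"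
    using assms by auto
  show "(\<lambda>(x, y). f x * g y) \<in> borel_measurable (leb a \<Otimes>\<^sub>M leb b)"
    by measurable
  show "integrable (leb a) (\<lambda>x. LINT y|leb b. norm (case (x, y) of (x, y) \<Rightarrow> f x * g y))"
    using assms by (simp add: abs_mult)
  show "AE x in leb a. integrable (leb b) (\<lambda>y. case (x, y) of (x, y) \<Rightarrow> f x * g y)"
    using assms by simp
qed

lemma integrable_pair_triangle:
  fixes f g :: "real \<Rightarrow> real"
  assumes "integrable (leb b) f" "integrable (leb b) g"
  shows "integrable (leb b \<Otimes>\<^sub>M leb b) (\<lambda>(x, y). if y < x then f x * g y else 0)"
proof (rule Bochner_Integration.integrable_bound[OF integrable_pair_mult[OF assms]])
  have [measurable]: "f \<in> borel_measurable (leb b)" "g \<in> borel_measurable (leb b)"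
    using assms by auto
  show "(\<lambda>(x, y). if y < x then f x * g y else 0) \<in> borel_measurable (leb b \<Otimes>\<^sub>M leb b)"
    unfolding case_prod_beta by measurable
qed (auto split: if_splits)

text \<open>Fubini on the triangle s < x, so \<open>g\<close> need only be integrable. No condition
  on \<open>\<phi>\<close> at 0 appears because the primitive vanishes there; this is used later
  with the function 2 (x - L), which vanishes only at the right end.\<close>

lemma prim_by_parts:
  assumes g: "integrable (leb b) g"
    and der: "\<And>x. (\<phi> has_real_derivative \<phi>' x) (at x)" and cont: "continuous_on UNIV \<phi>'"
    and "\<phi> b = 0"
  shows "(LINT x|leb b. prim b g x * \<phi>' x) = - (LINT x|leb b. g x * \<phi> x)"
proof -
  have \<phi>': "integrable (leb b) \<phi>'"
    by (intro L2_leb_integrable continuous_L2 continuous_on_subset[OF cont]) auto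
  have "(LINT x|leb b. prim b g x * \<phi>' x) =
      (LINT x|leb b. LINT s|leb b. (if s < x then \<phi>' x * g s else 0))"
    unfolding prim_def
    by (subst integral_mult_left_zero[symmetric])
      (intro Bochner_Integration.integral_cong refl, auto simp: mult.commute)
  also have "\<dots> = (LINT s|leb b. LINT x|leb b. (if s < x then \<phi>' x * g s else 0))"
    by (rule lebs.Fubini_integral[symmetric]) (rule integrable_pair_triangle[OF \<phi>' g])
  also have "\<dots> = (LINT s|leb b. g s * (LINT x|leb b. (if s < x then \<phi>' x else 0)))"
    by (subst integral_mult_right_zero[symmetric])
      (intro Bochner_Integration.integral_cong refl, auto simp: mult.commute)
  also have "\<dots> = (LINT s|leb b. - (g s * \<phi> s))"
    using integral_deriv_leb[OF der cont] assms(4)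
    by (intro Bochner_Integration.integral_cong refl) auto
  finally show ?thesis by simp
qed

text \<open>The triangle y < x and its mirror image fill the square up to the diagonal, a null set,
  and contribute equally. This replaces the chain rule for half the square of the primitive, and is
  the source of the sign in the energy estimates.\<close>

lemma prim_square:
  assumes g: "integrable (leb b) g"
  shows "(LINT x|leb b. g x * prim b g x) = (LINT x|leb b. g x)\<^sup>2 / 2"
proof -
  let ?T = "\<lambda>x y. if y < x then g x * g y else 0"
  have meas [measurable]: "g \<in> borel_measurable (leb b)"
    using g by auto
  have int: "integrable (leb b \<Otimes>\<^sub>M leb b) (\<lambda>(x, y). ?T x y)"
    by (rule integrable_pair_triangle[OF g g])
  have A: "(LINT x|leb b. g x * prim b g x) = (LINT x|leb b. LINT y|leb b. ?T x y)"
    unfolding prim_def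
    by (subst integral_mult_right_zero[symmetric])
      (intro Bochner_Integration.integral_cong refl, auto)
  have split: "(LINT y|leb b. ?T x y) + (LINT y|leb b. ?T y x) = g x * (LINT y|leb b. g y)" for x
  proof -
    have i: "integrable (leb b) (?T x)" "integrable (leb b) (\<lambda>y. ?T y x)"
      by (rule Bochner_Integration.integrable_bound[of _ "\<lambda>y. g x * g y"];
          use g in \<open>auto simp: mult.commute\<close>)+
    have "AE y in lborel. y \<noteq> x"
      by (rule AE_lborel_singleton)
    then have ne: "AE y in leb b. y \<noteq> x"
      by (subst AE_restrict_space_iff) auto
    have "(LINT y|leb b. ?T x y) + (LINT y|leb b. ?T y x) = (LINT y|leb b. ?T x y + ?T y x)"
      using i by simp
    also have "\<dots> = (LINT y|leb b. g x * g y)"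
      by (intro integral_cong_AE) (use ne in \<open>auto elim!: eventually_mono\<close>)
    finally show ?thesis by simp
  qed
  have i1: "integrable (leb b) (\<lambda>x. LINT y|leb b. ?T x y)"
    using lebs.integrable_fst[OF int] by simp
  have i2: "integrable (leb b) (\<lambda>x. LINT y|leb b. ?T y x)"
    using lebs.integrable_snd[OF int] by simp
  have "2 * (LINT x|leb b. LINT y|leb b. ?T x y) =
      (LINT x|leb b. LINT y|leb b. ?T x y) + (LINT x|leb b. LINT y|leb b. ?T y x)"
    using lebs.Fubini_integral[OF int] by simp
  also have "\<dots> = (LINT x|leb b. (LINT y|leb b. ?T x y) + (LINT y|leb b. ?T y x))"
    using i1 i2 by simp
  also have "\<dots> = (LINT x|leb b. g x)\<^sup>2"
    unfolding split by (simp add: power2_eq_square)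
  finally show ?thesis
    unfolding A by simp
qed

section \<open>Test functions approximating indicators, and the fundamental lemma\<close>

text \<open>A continuously differentiable approximation of the indicator of the interval from
  \<open>c\<close> to \<open>b\<close>. Squaring the positive parts removes their kinks, q / (1 + q)
  keeps the values between 0 and 1, and the shift by 1 keeps the support at distance 1 / n from both
  ends.\<close>

definition bump :: "real \<Rightarrow> real \<Rightarrow> real \<Rightarrow> real \<Rightarrow> real" where
  "bump b n c x = (let q = (max 0 (n * (x - c) - 1))\<^sup>2 * (max 0 (n * (b - x) - 1))\<^sup>2 in q / (1 + q))"

lemma DERIV_max_power2: "((\<lambda>y::real. (max 0 y)\<^sup>2) has_real_derivative 2 * max 0 y) (at y)"
proof -
  consider "y > 0" | "y < 0" | "y = 0" by linarith
  then show ?thesis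
  proof cases
    case 1
    have "((\<lambda>y::real. y\<^sup>2) has_real_derivative 2 * y) (at y)"
      by (auto intro!: derivative_eq_intros)
    then have "((\<lambda>y::real. (max 0 y)\<^sup>2) has_real_derivative 2 * y) (at y)"
      by (rule has_field_derivative_transform_within_open[of _ _ _ "{0<..}"]) (use 1 in auto)
    with 1 show ?thesis by simp
  next
    case 2
    have "((\<lambda>y::real. (max 0 y)\<^sup>2) has_real_derivative 0) (at y)"
      by (rule has_field_derivative_transform_within_open[OF DERIV_const[of 0], of "{..<0}"])
        (use 2 in auto)
    with 2 show ?thesis by simp
  next
    case 3
    have "((\<lambda>h::real. (max 0 h)\<^sup>2 / h) \<longlongrightarrow> 0) (at 0)"
    proof (rule Lim_null_comparison)
      show "\<forall>\<^sub>F h in at 0. norm ((max 0 h)\<^sup>2 / h) \<le> \<bar>h::real\<bar>"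
        by (intro always_eventually allI) (auto simp: max_def power2_eq_square)
      show "((\<lambda>h::real. \<bar>h\<bar>) \<longlongrightarrow> 0) (at 0)"
        by (auto intro!: tendsto_eq_intros)
    qed
    with 3 show ?thesis
      by (simp add: DERIV_def)
  qed
qed

lemma bump_range: "0 \<le> bump b n c x" "bump b n c x \<le> 1"
proof -
  have "q \<ge> 0 \<Longrightarrow> 0 \<le> q / (1 + q) \<and> q / (1 + q) \<le> 1" for q :: real
    by (auto simp: divide_simps)
  then show "0 \<le> bump b n c x" "bump b n c x \<le> 1"
    unfolding bump_def Let_def by (metis mult_nonneg_nonneg zero_le_power2)+
qed

lemma bump_outside:
  assumes "n > 0" "x \<notin> {c + 1 / n..b - 1 / n}"
  shows "bump b n c x = 0"
proof -
  have "n * (x - c) - 1 \<le> 0 \<or> n * (b - x) - 1 \<le> 0"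
    using assms by (auto simp: field_simps)
  then show ?thesis
    by (auto simp: bump_def)
qed

lemma test_fun_bump:
  assumes "n > 0" "c \<ge> 0"
  shows "test_fun b (bump b n c)"
proof -
  define a where "a = (\<lambda>x. n * (x - c) - 1)"
  define d where "d = (\<lambda>x. n * (b - x) - 1)"
  define q where "q = (\<lambda>x. (max 0 (a x))\<^sup>2 * (max 0 (d x))\<^sup>2)"
  define q' where "q' = (\<lambda>x. 2 * max 0 (a x) * n * (max 0 (d x))\<^sup>2 + (max 0 (a x))\<^sup>2 * (2 * max 0 (d x) * - n))"
  have bump: "bump b n c = (\<lambda>x. q x / (1 + q x))"
    by (simp add: fun_eq_iff bump_def q_def a_def d_def Let_def)
  have pos: "1 + q x > 0" for x
    by (simp add: q_def add_pos_nonneg)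
  have da: "((\<lambda>x. (max 0 (a x))\<^sup>2) has_real_derivative 2 * max 0 (a x) * n) (at x)" for x
    by (rule DERIV_chain2[OF DERIV_max_power2])
      (auto simp: a_def intro!: derivative_eq_intros)
  have dd: "((\<lambda>x. (max 0 (d x))\<^sup>2) has_real_derivative 2 * max 0 (d x) * - n) (at x)" for x
    by (rule DERIV_chain2[OF DERIV_max_power2])
      (auto simp: d_def intro!: derivative_eq_intros)
  have dq: "(q has_real_derivative q' x) (at x)" for x
    unfolding q_def q'_def using DERIV_mult'[OF da dd] by (simp add: algebra_simps)
  have der: "(bump b n c has_real_derivative q' x / (1 + q x)\<^sup>2) (at x)" for x
    unfolding bump using pos[of x]
    by (auto intro!: derivative_eq_intros dq simp: power2_eq_square algebra_simps)
  then have deriv: "deriv (bump b n c) = (\<lambda>x. q' x / (1 + q x)\<^sup>2)"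
    by (intro ext DERIV_imp_deriv)
  have ca: "continuous_on UNIV a" "continuous_on UNIV d"
    unfolding a_def d_def by (auto intro!: continuous_intros)
  have "1 + q x \<noteq> 0" for x
    using pos[of x] by simp
  then have cont: "continuous_on UNIV (deriv (bump b n c))"
    unfolding deriv using ca
    by (auto simp: q_def q'_def intro!: continuous_intros)
  show ?thesis
    unfolding test_fun_def
  proof (intro conjI)
    show "\<forall>x. bump b n c differentiable at x"
      using der real_differentiable_def by blast
    have "0 < c + 1 / n" "b - 1 / n < b"
      using assms by (auto intro!: add_nonneg_pos)
    then show "\<exists>c' d'. 0 < c' \<and> d' < b \<and> (\<forall>x. x \<notin> {c'..d'} \<longrightarrow> bump b n c x = 0)"
      using bump_outside[OF assms(1)] by blast
  qed (rule cont)
qed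

lemma bump_tendsto:
  assumes "x \<in> {0<..<b}"
  shows "(\<lambda>n. bump b (real (Suc n)) c x) \<longlonglongrightarrow> (if c < x then 1 else 0)"
proof (cases "c < x")
  case False
  have "bump b (real (Suc n)) c x = 0" for n
  proof (rule bump_outside)
    have "0 < 1 / real (Suc n)"
      by simp
    then show "x \<notin> {c + 1 / real (Suc n)..b - 1 / real (Suc n)}"
      using False unfolding atLeastAtMost_iff by linarith
  qed simp
  then show ?thesis
    using False by simp
next
  case True
  let ?q = "\<lambda>n. (max 0 (real (Suc n) * (x - c) - 1))\<^sup>2 * (max 0 (real (Suc n) * (b - x) - 1))\<^sup>2"
  have lin: "filterlim (\<lambda>n. (max 0 (real (Suc n) * e - 1))\<^sup>2) at_top sequentially" if "e > 0" for e
  proof -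
    have "filterlim (\<lambda>n. real (Suc n) * e) at_top sequentially"
      using that filterlim_compose[OF filterlim_real_sequentially filterlim_Suc]
      by (intro filterlim_at_top_mult_tendsto_pos[OF tendsto_const])
    then have "filterlim (\<lambda>n. - 1 + real (Suc n) * e) at_top sequentially"
      by (rule filterlim_tendsto_add_at_top[OF tendsto_const])
    then have "filterlim (\<lambda>n. max 0 (real (Suc n) * e - 1)) at_top sequentially"
      by (rule filterlim_at_top_mono) (auto intro!: always_eventually)
    then show ?thesis
      by (rule filterlim_pow_at_top[rotated]) simp
  qed
  have q: "filterlim ?q at_top sequentially"
    using True assms by (intro filterlim_at_top_mult_at_top lin) auto
  have "filterlim (\<lambda>n. 1 + ?q n) at_top sequentially"
    by (rule filterlim_tendsto_add_at_top[OF tendsto_const q])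
  \<comment> \<open>Since q / (1 + q) = 1 - 1 / (1 + q), divergence of q suffices.\<close>
  then have "(\<lambda>n. 1 - inverse (1 + ?q n)) \<longlonglongrightarrow> 1 - 0"
    by (intro tendsto_diff tendsto_const tendsto_inverse_0_at_top)
  moreover have "1 - inverse (1 + ?q n) = bump b (real (Suc n)) c x" for n
  proof -
    have "1 + ?q n > 0"
      by (intro add_pos_nonneg mult_nonneg_nonneg) auto
    then show ?thesis
      unfolding bump_def Let_def by (simp only: divide_inverse) (simp add: field_simps)
  qed
  ultimately show ?thesis
    using True by simp
qed

lemma integral_bump_tendsto:
  assumes w: "integrable (leb b) w" and "c \<ge> 0"
  shows "(\<lambda>n. LINT x|leb b. bump b (real (Suc n)) c x * w x) \<longlonglongrightarrow> (LINT x|leb b. (if c < x then w x else 0))"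
proof (rule integral_dominated_convergence[where w = "\<lambda>x. \<bar>w x\<bar>"])
  have [measurable]: "w \<in> borel_measurable (leb b)"
    using w by auto
  show "(\<lambda>x. if c < x then w x else 0) \<in> borel_measurable (leb b)"
    by measurable
  have [measurable]: "bump b (real (Suc n)) c \<in> borel_measurable (leb b)" for n
    using test_fun_L2(1)[OF test_fun_bump] assms(2) by (intro L2_borel_measurable) auto
  show "(\<lambda>x. bump b (real (Suc n)) c x * w x) \<in> borel_measurable (leb b)" for n
    by measurable
  show "AE x in leb b. (\<lambda>n. bump b (real (Suc n)) c x * w x) \<longlonglongrightarrow> (if c < x then w x else 0)"
  proof (rule AE_I2)
    fix x assume "x \<in> space (leb b)"
    then have "(\<lambda>n. bump b (real (Suc n)) c x * w x) \<longlonglongrightarrow> (if c < x then 1 else 0) * w x"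
      by (intro tendsto_mult bump_tendsto tendsto_const) simp
    then show "(\<lambda>n. bump b (real (Suc n)) c x * w x) \<longlonglongrightarrow> (if c < x then w x else 0)"
      by (simp split: if_splits)
  qed
  show "AE x in leb b. norm (bump b (real (Suc n)) c x * w x) \<le> \<bar>w x\<bar>" for n
    using bump_range[of b "real (Suc n)" c]
    by (intro AE_I2) (auto simp: abs_mult intro!: mult_left_le_one_le)
qed (use w in auto)

text \<open>As \<open>ennreal\<close> sends negative numbers to 0, the two densities below are the
  positive and the negative part of \<open>w\<close>. The measures agree on all rays and are finite
  there, hence are equal; so are their densities almost everywhere, and a number with equal positive
  and negative parts is 0.\<close>

lemma AE_zero_if_tail_integrals_zero:
  fixes w :: "real \<Rightarrow> real"
  assumes w: "integrable lborel w"
    and zero: "\<And>x. (LINT y|lborel. indicator {x<..} y * w y) = 0"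
  shows "AE x in lborel. w x = 0"
proof -
  have [measurable]: "w \<in> borel_measurable borel"
    using w by auto
  have fin: "(\<integral>\<^sup>+y. ennreal (s * w y) * indicator {x<..} y \<partial>lborel) < \<infinity>" if "\<bar>s\<bar> = 1" for x s
  proof -
    have "(\<integral>\<^sup>+y. ennreal (s * w y) * indicator {x<..} y \<partial>lborel) \<le> (\<integral>\<^sup>+y. ennreal (norm (w y)) \<partial>lborel)"
      using that by (intro nn_integral_mono)
        (auto simp: indicator_def abs_if split: if_splits intro!: ennreal_leI)
    then show ?thesis
      using w by (auto simp: integrable_iff_bounded le_less_trans)
  qed
  have "density lborel (\<lambda>x. ennreal (w x)) = density lborel (\<lambda>x. ennreal (- w x))"
  proof (rule measure_eqI_lessThan)
    fix x :: real
    have pos: "emeasure (density lborel (\<lambda>x. ennreal (w x))) {x<..} =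
        (\<integral>\<^sup>+y. ennreal (indicator {x<..} y * w y) \<partial>lborel)"
      by (subst emeasure_density) (auto intro!: nn_integral_cong simp: indicator_def)
    have neg: "emeasure (density lborel (\<lambda>x. ennreal (- w x))) {x<..} =
        (\<integral>\<^sup>+y. ennreal (- (indicator {x<..} y * w y)) \<partial>lborel)"
      by (subst emeasure_density) (auto intro!: nn_integral_cong simp: indicator_def)
    have finp: "emeasure (density lborel (\<lambda>x. ennreal (w x))) {x<..} < \<infinity>"
      using fin[of 1 x] by (subst emeasure_density) auto
    have finn: "emeasure (density lborel (\<lambda>x. ennreal (- w x))) {x<..} < \<infinity>"
      using fin[of "-1" x] by (subst emeasure_density) auto
    show "emeasure (density lborel (\<lambda>x. ennreal (w x))) {x<..} < \<infinity>"
      by (rule finp)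
    have "integrable lborel (\<lambda>y. indicator {x<..} y * w y)"
      using integrable_mult_indicator[OF _ w, of "{x<..}"] by simp
    then have "enn2real (emeasure (density lborel (\<lambda>x. ennreal (w x))) {x<..}) =
        enn2real (emeasure (density lborel (\<lambda>x. ennreal (- w x))) {x<..})"
      using zero[of x] unfolding pos neg by (subst (asm) real_lebesgue_integral_def) auto
    then show "emeasure (density lborel (\<lambda>x. ennreal (w x))) {x<..} =
        emeasure (density lborel (\<lambda>x. ennreal (- w x))) {x<..}"
      using finp finn by (metis ennreal_enn2real infinity_ennreal_def)
  qed auto
  then have "AE x in lborel. ennreal (w x) = ennreal (- w x)"
    by (intro sigma_finite_measure.density_unique[OF lborel.sigma_finite_measure_axioms]) auto
  then show ?thesis
  proof eventually_elim
    case (elim x)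
    show ?case
    proof (rule ccontr)
      assume "w x \<noteq> 0"
      then show False
        using elim by (cases "w x > 0") (auto simp: ennreal_neg ennreal_eq_0_iff dest: sym)
    qed
  qed
qed

text \<open>
  Only countably many test functions occur, so that for functions of \<open>t\<close> and \<open>x\<close> a hypothesis
  which holds for each test function and almost every \<open>t\<close> can be used at almost every \<open>t\<close>.
\<close>

lemma AE_zero_if_bump_integrals_zero:
  assumes "b > 0" and w: "integrable (leb b) w"
    and zero: "\<And>n c. c \<in> \<rat> \<Longrightarrow> (LINT x|leb b. bump b (real (Suc n)) (max 0 c) x * w x) = 0"
  shows "AE x in leb b. w x = 0"
proof -
  have [measurable]: "w \<in> borel_measurable (leb b)"
    using w by auto
  have rat: "(LINT x|leb b. (if c < x then w x else 0)) = 0" if "c \<in> \<rat>" for c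
  proof -
    \<comment> \<open>Truncation at 0 makes \<open>bump\<close> a test function on the interval and
      leaves the cut-off unchanged there.\<close>
    have "(LINT x|leb b. (if max 0 c < x then w x else 0)) = 0"
      using LIMSEQ_unique[OF integral_bump_tendsto[OF w max.cobounded1, of c]] zero[OF that] by simp
    moreover have "(LINT x|leb b. (if max 0 c < x then w x else 0)) =
        (LINT x|leb b. (if c < x then w x else 0))"
      by (intro Bochner_Integration.integral_cong) auto
    ultimately show ?thesis by simp
  qed
  \<comment> \<open>The rationals approach \<open>c\<close> from above: then the cut-offs converge
    at every \<open>x\<close>, including \<open>x = c\<close>.\<close>
  have real: "(LINT x|leb b. (if c < x then w x else 0)) = 0" for c
  proof -
    have "\<exists>r\<in>\<rat>. c < r \<and> r < c + 1 / real (Suc n)" for n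
      by (intro Rats_dense_in_real) simp
    then obtain r where r: "\<And>n. r n \<in> \<rat>" "\<And>n. c < r n" "\<And>n. r n < c + 1 / real (Suc n)"
      by metis
    have "(\<lambda>n. c + 1 / real (Suc n)) \<longlonglongrightarrow> c + 0"
      by (intro tendsto_add tendsto_const) (rule LIMSEQ_Suc[OF lim_1_over_n])
    then have lim: "r \<longlonglongrightarrow> c"
      using r by (intro real_tendsto_sandwich[of "\<lambda>_. c" r _ "\<lambda>n. c + 1 / real (Suc n)"])
        (auto intro!: always_eventually less_imp_le)
    have "(\<lambda>n. LINT x|leb b. (if r n < x then w x else 0)) \<longlonglongrightarrow> (LINT x|leb b. (if c < x then w x else 0))"
    proof (rule integral_dominated_convergence[where w = "\<lambda>x. \<bar>w x\<bar>"])
      show "AE x in leb b. (\<lambda>n. if r n < x then w x else 0) \<longlonglongrightarrow> (if c < x then w x else 0)"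
      proof (rule AE_I2, cases)
        fix x assume "c < x"
        have "eventually (\<lambda>n. r n < x) sequentially"
          using lim \<open>c < x\<close> by (rule order_tendstoD)
        then have "eventually (\<lambda>n. (if r n < x then w x else 0) = (if c < x then w x else 0)) sequentially"
          by eventually_elim (use \<open>c < x\<close> in auto)
        then show "(\<lambda>n. if r n < x then w x else 0) \<longlonglongrightarrow> (if c < x then w x else 0)"
          by (rule tendsto_eventually)
      next
        fix x assume "\<not> c < x"
        then have "\<not> r n < x" for n
          using r(2)[of n] by linarith
        then show "(\<lambda>n. if r n < x then w x else 0) \<longlonglongrightarrow> (if c < x then w x else 0)"
          using \<open>\<not> c < x\<close> by simp
      qed
    qed (use w in auto)
    then have "(\<lambda>n. 0) \<longlonglongrightarrow> (LINT x|leb b. (if c < x then w x else 0))"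
      by (simp add: rat[OF r(1)])
    then show ?thesis
      using LIMSEQ_unique[OF _ tendsto_const] by blast
  qed
  define v where "v = (\<lambda>x. indicator {0<..<b} x * w x)"
  have v: "integrable lborel v"
    using w by (simp add: v_def integrable_restrict_space)
  have "(LINT y|lborel. indicator {x<..} y * v y) = 0" for x
  proof -
    have "(LINT y|lborel. indicator {x<..} y * v y) =
        (LINT y|lborel. indicator {0<..<b} y *\<^sub>R (if x < y then w y else 0))"
      by (intro Bochner_Integration.integral_cong) (auto simp: v_def indicator_def)
    also have "\<dots> = (LINT y|leb b. (if x < y then w y else 0))"
      by (rule integral_restrict_space[symmetric]) simp
    finally show ?thesis
      using real by simp
  qed
  then have "AE x in lborel. v x = 0"
    using v by (intro AE_zero_if_tail_integrals_zero)
  then have "AE x in lborel. x \<in> {0<..<b} \<longrightarrow> w x = 0"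
    by eventually_elim (auto simp: v_def)
  then show ?thesis
    by (subst AE_restrict_space_iff) auto
qed

lemma fundamental_lemma:
  assumes "b > 0" "integrable (leb b) w"
    and zero: "\<And>\<phi>. test_fun b \<phi> \<Longrightarrow> (LINT x|leb b. w x * \<phi> x) = 0"
  shows "AE x in leb b. w x = 0"
proof (rule AE_zero_if_bump_integrals_zero[OF assms(1,2)])
  fix n c
  show "(LINT x|leb b. bump b (real (Suc n)) (max 0 c) x * w x) = 0"
    using zero[OF test_fun_bump, of "real (Suc n)" "max 0 c"] by (simp add: mult.commute)
qed

text \<open>An antiderivative is constant on either side of the support of \<open>h\<close>.
  Normalising it at 0 makes the left constant vanish, and mean zero then makes the right one
  vanish.\<close>

lemma test_fun_antiderivative:
  assumes "b > 0" "continuous_on UNIV h" and cd: "0 < c" "d < b" "\<And>x. x \<notin> {c..d} \<Longrightarrow> h x = 0"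
    and "(LINT x|leb b. h x) = 0"
  obtains \<phi> where "test_fun b \<phi>" "deriv \<phi> = h"
proof -
  have "\<exists>F. \<forall>x::real. (- \<infinity>::ereal) < x \<longrightarrow> x < (\<infinity>::ereal) \<longrightarrow> (F has_vector_derivative h x) (at x)"
    using assms(2) by (intro einterval_antiderivative) (auto simp: continuous_on_eq_continuous_at)
  then obtain F where F: "\<And>x. (F has_real_derivative h x) (at x)"
    by (auto simp: has_real_derivative_iff_has_vector_derivative)
  define \<phi> where "\<phi> = (\<lambda>x. F x - F 0)"
  have der: "(\<phi> has_real_derivative h x) (at x)" for x
    unfolding \<phi>_def using F by (auto intro!: derivative_eq_intros)
  then have deriv: "deriv \<phi> = h"
    by (intro ext DERIV_imp_deriv)
  have const: "\<phi> x = \<phi> y" if "x \<le> y" "\<And>z. z \<in> {x..y} \<Longrightarrow> h z = 0" for x y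
  proof (cases "x = y")
    case False
    have "(\<phi> has_real_derivative 0) (at z)" if "z \<in> {x..y}" for z
      using der[of z] \<open>\<And>z. z \<in> {x..y} \<Longrightarrow> h z = 0\<close>[OF that] by simp
    then show ?thesis
      using that(1) False by (intro DERIV_isconst2[of x y \<phi> y, symmetric])
        (auto intro!: DERIV_continuous_on[of _ \<phi> "\<lambda>_. 0"] intro: has_field_derivative_at_within)
  qed simp
  have left: "\<phi> x = 0" if "x < c" for x
  proof -
    have "\<phi> x = \<phi> 0"
    proof (cases "x \<le> 0")
      case True
      then show ?thesis
        using cd by (intro const) auto
    next
      case False
      then show ?thesis
        using cd that by (intro const[symmetric]) auto
    qed
    then show ?thesis
      by (simp add: \<phi>_def)
  qed
  have "(LINT x|leb b. h x) = (LINT x|leb b. (if 0 < x then h x else 0))"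
    by (intro Bochner_Integration.integral_cong) auto
  also have "\<dots> = \<phi> b - \<phi> 0"
    using assms(1,2) by (intro integral_deriv_leb der) auto
  finally have b0: "\<phi> b = 0"
    using assms(6) by (simp add: \<phi>_def)
  have right: "\<phi> x = 0" if "x > d" for x
  proof (cases "x \<le> b")
    case True
    then have "\<phi> x = \<phi> b"
      using cd that by (intro const) auto
    then show ?thesis
      using b0 by simp
  next
    case False
    then have "\<phi> b = \<phi> x"
      using cd by (intro const) auto
    then show ?thesis
      using b0 by simp
  qed
  have "test_fun b \<phi>"
    unfolding test_fun_def deriv
    using der assms(2) cd left right
    by (intro conjI allI exI[of _ c] exI[of _ d])
      (auto simp: real_differentiable_def not_le)
  then show ?thesis
    using deriv that by blast
qed

text \<open>Subtracting from a test function \<theta> the multiple of a fixed \<eta> that has the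
  same integral gives a function of mean zero, hence the derivative of a test function. Testing with
  it shows that \<open>f\<close> minus a constant annihilates \<theta>.\<close>

lemma du_Bois_Reymond:
  assumes b: "b > 0" and f: "integrable (leb b) f"
    and zero: "\<And>\<phi>. test_fun b \<phi> \<Longrightarrow> (LINT x|leb b. f x * deriv \<phi> x) = 0"
  shows "\<exists>m. AE x in leb b. f x = m"
proof -
  \<comment> \<open>If all test functions had mean zero, the fundamental lemma would make the
    constant 1 vanish almost everywhere.\<close>
  have "\<exists>\<eta>. test_fun b \<eta> \<and> (LINT x|leb b. \<eta> x) \<noteq> 0"
  proof (rule ccontr)
    assume "\<not> ?thesis"
    then have "AE x in leb b. (1::real) = 0"
      by (intro fundamental_lemma[OF b]) auto
    then show False
      using AE_leb_limit[OF b, of 0 "\<lambda>_. 1" 0 1] b by simp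
  qed
  then obtain \<eta> where \<eta>: "test_fun b \<eta>" "(LINT x|leb b. \<eta> x) \<noteq> 0"
    by blast
  define I where "I = (LINT x|leb b. \<eta> x)"
  have I0: "I \<noteq> 0"
    using \<eta>(2) by (simp add: I_def)
  define m where "m = (LINT x|leb b. f x * \<eta> x) / I"
  have "AE x in leb b. f x - m = 0"
  proof (rule fundamental_lemma[OF b])
    show "integrable (leb b) (\<lambda>x. f x - m)"
      using f by simp
    fix \<theta> assume \<theta>: "test_fun b \<theta>"
    define s where "s = (LINT x|leb b. \<theta> x)"
    have int: "integrable (leb b) \<theta>" "integrable (leb b) \<eta>"
      using test_fun_L2 \<theta> \<eta> by (auto intro: L2_leb_integrable)
    have intf: "integrable (leb b) (\<lambda>x. f x * \<theta> x)" "integrable (leb b) (\<lambda>x. f x * \<eta> x)"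
      using test_fun_continuous(1) \<theta> \<eta> by (auto intro!: integrable_mult_continuous f)
    obtain c1 d1 where 1: "0 < c1" "d1 < b" "\<And>x. x \<notin> {c1..d1} \<Longrightarrow> \<theta> x = 0"
      using \<theta> unfolding test_fun_def by blast
    obtain c2 d2 where 2: "0 < c2" "d2 < b" "\<And>x. x \<notin> {c2..d2} \<Longrightarrow> \<eta> x = 0"
      using \<eta> unfolding test_fun_def by blast
    obtain \<phi> where \<phi>: "test_fun b \<phi>" "deriv \<phi> = (\<lambda>x. \<theta> x - s / I * \<eta> x)"
    proof (rule test_fun_antiderivative[OF b])
      show "continuous_on UNIV (\<lambda>x. \<theta> x - s / I * \<eta> x)"
        by (intro continuous_intros test_fun_continuous(1)[OF \<theta>] test_fun_continuous(1)[OF \<eta>(1)])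
      show "0 < min c1 c2" "max d1 d2 < b"
        using 1 2 by auto
      show "\<theta> x - s / I * \<eta> x = 0" if "x \<notin> {min c1 c2..max d1 d2}" for x
      proof -
        have "\<theta> x = 0" "\<eta> x = 0"
          using that using 1(3)[of x] 2(3)[of x] by (auto simp: min_le_iff_disj le_max_iff_disj)
        then show ?thesis by simp
      qed
      show "(LINT x|leb b. \<theta> x - s / I * \<eta> x) = 0"
        using int \<eta>(2) by (simp add: s_def[symmetric] I_def[symmetric])
    qed
    have "0 = (LINT x|leb b. f x * \<theta> x - s / I * (f x * \<eta> x))"
      using zero[OF \<phi>(1)] by (simp add: \<phi>(2) algebra_simps)
    also have "\<dots> = (LINT x|leb b. f x * \<theta> x) - s * m"
      using intf by (simp add: m_def)
    also have "\<dots> = (LINT x|leb b. f x * \<theta> x - m * \<theta> x)"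
      using intf int by (simp add: s_def)
    finally show "(LINT x|leb b. (f x - m) * \<theta> x) = 0"
      by (simp add: algebra_simps)
  qed
  then show ?thesis
    by (auto elim!: eventually_mono)
qed

text \<open>The primitive of \<open>g\<close> has weak derivative \<open>g\<close> as well, so the
  difference has weak derivative 0. The lemma serves both variables: for members of
  \<open>V0\<close> in space, and for tested states in time.\<close>

lemma weak_primitive:
  assumes b: "b > 0" and f: "integrable (leb b) f" and g: "integrable (leb b) g"
    and weak: "\<And>\<phi>. test_fun b \<phi> \<Longrightarrow>
      (LINT x|leb b. f x * deriv \<phi> x) = - (LINT x|leb b. g x * \<phi> x)"
  shows "\<exists>m. AE x in leb b. f x = m + prim b g x"
proof -
  have p: "integrable (leb b) (prim b g)"
    by (intro L2_leb_integrable continuous_L2 continuous_on_prim g)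
  have "\<exists>m. AE x in leb b. f x - prim b g x = m"
  proof (rule du_Bois_Reymond[OF b])
    show "integrable (leb b) (\<lambda>x. f x - prim b g x)"
      using f p by simp
    fix \<phi> assume \<phi>: "test_fun b \<phi>"
    have "(LINT x|leb b. prim b g x * deriv \<phi> x) = - (LINT x|leb b. g x * \<phi> x)"
      using test_fun_deriv[OF \<phi>] test_fun_continuous[OF \<phi>] test_fun_zero[OF \<phi>]
      by (intro prim_by_parts g) auto
    moreover have "integrable (leb b) (\<lambda>x. f x * deriv \<phi> x)"
      "integrable (leb b) (\<lambda>x. prim b g x * deriv \<phi> x)"
      using test_fun_continuous(2)[OF \<phi>] by (auto intro!: integrable_mult_continuous f p)
    ultimately show "(LINT x|leb b. (f x - prim b g x) * deriv \<phi> x) = 0"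
      using weak[OF \<phi>] by (simp add: left_diff_distrib)
  qed
  then show ?thesis
    by (auto elim!: eventually_mono simp: algebra_simps)
qed

section \<open>Point values, and \<open>V0\<close> as the space of primitives\<close>

text \<open>Two continuous representatives differ by a continuous function that is 0 almost
  everywhere, hence 0 also at the ends by passing to the limit; so the description in
  \<open>point_val\<close> is unique.\<close>

lemma point_val_continuous:
  assumes "b > 0" "continuous_on {0..b} c" "AE x in leb b. c x = v x" "a \<in> {0..b}"
  shows "point_val b v a = c a"
  unfolding point_val_def
proof (rule the_equality)
  show "\<exists>c'. continuous_on {0..b} c' \<and> (AE x in leb b. c' x = v x) \<and> c' a = c a"
    using assms by blast
  fix y assume "\<exists>c'. continuous_on {0..b} c' \<and> (AE x in leb b. c' x = v x) \<and> c' a = y"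
  then obtain c' where c': "continuous_on {0..b} c'" "AE x in leb b. c' x = v x" "c' a = y"
    by blast
  have "((\<lambda>x. c' x - c x) \<longlongrightarrow> c' a - c a) (at a within {0..b})"
    using c'(1) assms(2,4) by (intro tendsto_diff) (auto simp: continuous_on_def)
  moreover have "AE x in leb b. c' x - c x = 0"
    using c'(2) assms(3) by eventually_elim simp
  ultimately have "c' a - c a = 0"
    by (intro AE_leb_limit[OF assms(1,4)])
  then show "y = c a"
    using c'(3) by simp
qed

lemma weak_deriv_prim:
  assumes "g \<in> L2 (leb b)"
  shows "weak_deriv b (prim b g) g"
  unfolding weak_deriv_def
proof (intro conjI allI impI assms)
  have g: "integrable (leb b) g"
    using assms by (rule L2_leb_integrable)
  show "prim b g \<in> L2 (leb b)"
    by (intro continuous_L2 continuous_on_prim g)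
  fix \<phi> assume \<phi>: "test_fun b \<phi>"
  show "(LINT x|leb b. prim b g x * deriv \<phi> x) = - (LINT x|leb b. g x * \<phi> x)"
    using test_fun_deriv[OF \<phi>] test_fun_continuous[OF \<phi>] test_fun_zero[OF \<phi>]
    by (intro prim_by_parts g) auto
qed

lemma point_val_prim:
  assumes "b > 0" "g \<in> L2 (leb b)" "a \<in> {0..b}"
  shows "point_val b (prim b g) a = prim b g a"
  using assms by (intro point_val_continuous continuous_on_prim L2_leb_integrable) auto

lemma prim_V0: "b > 0 \<Longrightarrow> g \<in> L2 (leb b) \<Longrightarrow> prim b g \<in> V0 b"
  using weak_deriv_prim point_val_prim[of b g 0] by (auto simp: V0_def H1_def prim_0)

text \<open>The constant left open by \<open>weak_primitive\<close> is the point value at 0.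
  Together with \<open>prim_V0\<close> this parametrises \<open>V0\<close> by arbitrary derivatives
  in \<open>L2\<close>, which turns both test spaces into \<open>L2\<close>.\<close>

lemma V0_eq_prim:
  assumes "b > 0" "v \<in> V0 b" "weak_deriv b v g"
  shows "AE x in leb b. v x = prim b g x"
proof -
  have g: "integrable (leb b) g" and v: "integrable (leb b) v"
    using assms(3) L2_leb_integrable unfolding weak_deriv_def by blast+
  obtain m where m: "AE x in leb b. v x = m + prim b g x"
    using weak_primitive[OF assms(1) v g] assms(3) unfolding weak_deriv_def by blast
  have "AE x in leb b. m + prim b g x = v x"
    using m by eventually_elim simp
  then have "point_val b v 0 = m + prim b g 0"
    using assms(1) by (intro point_val_continuous continuous_intros continuous_on_prim g) auto
  then have "m = 0"
    using assms(2) by (simp add: V0_def prim_0)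
  then show ?thesis
    using m by simp
qed

section \<open>Functions of time and space\<close>

abbreviation leb2 :: "real \<Rightarrow> real \<Rightarrow> (real \<times> real) measure" where
  "leb2 T L \<equiv> leb T \<Otimes>\<^sub>M leb L"

lemma L2_leb2_slices:
  assumes "case_prod f \<in> L2 (leb2 T L)"
  shows "AE t in leb T. f t \<in> L2 (leb L)" "AE x in leb L. (\<lambda>t. f t x) \<in> L2 (leb T)"
proof -
  have m [measurable]: "case_prod f \<in> borel_measurable (leb2 T L)"
    and i: "integrable (leb2 T L) (\<lambda>(t, x). (f t x)\<^sup>2)"
    using assms by (auto simp: L2_def case_prod_beta')
  have "AE t in leb T. t \<in> space (leb T)"
    by (rule AE_space)
  with lebs.AE_integrable_fst[OF i] show "AE t in leb T. f t \<in> L2 (leb L)"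
  proof eventually_elim
    case (elim t)
    then show ?case
      using measurable_Pair2[OF m, of t] by (simp add: L2_def)
  qed
  have "AE x in leb L. x \<in> space (leb L)"
    by (rule AE_space)
  with lebs.AE_integrable_snd[OF i] show "AE x in leb L. (\<lambda>t. f t x) \<in> L2 (leb T)"
  proof eventually_elim
    case (elim x)
    then show ?case
      using measurable_Pair1[OF m, of x] by (simp add: L2_def)
  qed
qed

text \<open>Fubini for the square. From here on the Bochner space is \<open>L2\<close> of the
  product measure, so that the general statements about \<open>L2 M\<close> apply to states.\<close>

lemma L2L2_iff: "f \<in> L2L2 T L \<longleftrightarrow> case_prod f \<in> L2 (leb2 T L)"
proof
  assume f: "f \<in> L2L2 T L"
  then have m: "case_prod f \<in> borel_measurable (leb2 T L)"
    by (simp add: L2L2_def)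
  have "integrable (leb2 T L) (\<lambda>(t, x). (f t x)\<^sup>2)"
  proof (rule lebs.Fubini_integrable)
    show "(\<lambda>(t, x). (f t x)\<^sup>2) \<in> borel_measurable (leb2 T L)"
      using m by (simp add: case_prod_beta')
    show "integrable (leb T) (\<lambda>t. LINT x|leb L. norm (case (t, x) of (t, x) \<Rightarrow> (f t x)\<^sup>2))"
      using f by (auto simp: L2L2_def L2_def L2_norm_power2)
    show "AE t in leb T. integrable (leb L) (\<lambda>x. case (t, x) of (t, x) \<Rightarrow> (f t x)\<^sup>2)"
      using f by (auto simp: L2L2_def L2_def)
  qed
  then show "case_prod f \<in> L2 (leb2 T L)"
    using m by (simp add: L2_def case_prod_beta')
next
  assume f: "case_prod f \<in> L2 (leb2 T L)"
  then have m: "case_prod f \<in> borel_measurable (leb2 T L)"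
    and i: "integrable (leb2 T L) (\<lambda>(t, x). (f t x)\<^sup>2)"
    by (auto simp: L2_def case_prod_beta')
  have "integrable (leb T) (\<lambda>t. LINT x|leb L. (f t x)\<^sup>2)"
    using lebs.integrable_fst[OF i] by simp
  then have "(\<lambda>t. L2_norm (leb L) (f t)) \<in> L2 (leb T)"
    unfolding L2_def by (auto simp: L2_norm_power2) (auto simp: L2_norm_def)
  then show "f \<in> L2L2 T L"
    using m L2_leb2_slices(1)[OF f] by (simp add: L2L2_def)
qed

lemma Fubini_power2:
  assumes "case_prod f \<in> L2 (leb2 T L)"
  shows "(LINT t|leb T. LINT x|leb L. (f t x)\<^sup>2) = (LINT p|leb2 T L. (case_prod f p)\<^sup>2)"
proof -
  have "integrable (leb2 T L) (\<lambda>(t, x). (f t x)\<^sup>2)"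
    using assms by (simp add: L2_def case_prod_beta')
  from lebs.integral_fst[OF this] show ?thesis
    by (simp add: case_prod_beta')
qed

lemma L2L2_norm_power2:
  assumes "case_prod f \<in> L2 (leb2 T L)"
  shows "(L2L2_norm T L f)\<^sup>2 = (LINT p|leb2 T L. (case_prod f p)\<^sup>2)"
  unfolding L2L2_norm_def L2_norm_power2 by (rule Fubini_power2[OF assms])

lemma L2_pair_mult:
  assumes "a \<in> L2 (leb T)" "b \<in> L2 (leb L)"
  shows "(\<lambda>(t, x). a t * b x) \<in> L2 (leb2 T L)"
proof -
  have [measurable]: "a \<in> borel_measurable (leb T)" "b \<in> borel_measurable (leb L)"
    using assms by (auto simp: L2_def)
  have "integrable (leb2 T L) (\<lambda>(t, x). (a t)\<^sup>2 * (b x)\<^sup>2)"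
    using assms by (intro integrable_pair_mult) (auto simp: L2_def)
  then show ?thesis
    by (auto simp: L2_def case_prod_beta' power_mult_distrib)
qed

lemma integrable_leb2_mult:
  assumes "case_prod f \<in> L2 (leb2 T L)" "a \<in> L2 (leb T)" "b \<in> L2 (leb L)"
  shows "integrable (leb2 T L) (\<lambda>(t, x). f t x * (a t * b x))"
  using L2_integrable_mult[OF assms(1) L2_pair_mult[OF assms(2,3)]] by (simp add: case_prod_beta')

lemma Fubini_mult:
  assumes "case_prod f \<in> L2 (leb2 T L)" "a \<in> L2 (leb T)" "b \<in> L2 (leb L)"
  shows "(LINT t|leb T. (LINT x|leb L. f t x * b x) * a t) = (LINT x|leb L. (LINT t|leb T. f t x * a t) * b x)"
proof -
  have "(LINT t|leb T. (LINT x|leb L. f t x * b x) * a t) =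
      (LINT t|leb T. LINT x|leb L. f t x * (a t * b x))"
    by (subst integral_mult_left_zero[symmetric])
      (intro Bochner_Integration.integral_cong refl, auto simp: mult_ac)
  also have "\<dots> = (LINT x|leb L. LINT t|leb T. f t x * (a t * b x))"
    by (rule lebs.Fubini_integral[symmetric]) (rule integrable_leb2_mult[OF assms])
  also have "\<dots> = (LINT x|leb L. (LINT t|leb T. f t x * a t) * b x)"
    by (subst integral_mult_left_zero[symmetric])
      (intro Bochner_Integration.integral_cong refl, auto simp: mult_ac)
  finally show ?thesis .
qed

lemma integrable_space_integral:
  assumes "case_prod f \<in> L2 (leb2 T L)" "b \<in> L2 (leb L)"
  shows "integrable (leb T) (\<lambda>t. LINT x|leb L. f t x * b x)"
  using lebs.integrable_fst[OF integrable_leb2_mult[OF assms(1) L2_const[OF finite_measure_leb] assms(2)], of 1]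
  by simp

lemma L2_less: "(\<lambda>s. if s < t then 1 else 0) \<in> L2 (leb b)"
  by (intro L2_bounded[where c = 1] finite_measure_leb) auto

lemma prim_time_integrable:
  assumes "case_prod y \<in> L2 (leb2 T L)"
  shows "integrable (leb L) (\<lambda>x. prim T (\<lambda>s. y s x) t)"
proof -
  have "integrable (leb2 T L) (\<lambda>(s, x). y s x * ((if s < t then 1 else 0) * 1))"
    using assms L2_less L2_const[OF finite_measure_leb] by (rule integrable_leb2_mult)
  from lebs.integrable_snd[OF this] show ?thesis
    unfolding prim_def by (rule Bochner_Integration.integrable_cong[THEN iffD1, rotated 2])
      (auto intro!: Bochner_Integration.integral_cong)
qed

lemma prim_time_Fubini:
  assumes "case_prod y \<in> L2 (leb2 T L)" "\<theta> \<in> L2 (leb L)"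
  shows "prim T (\<lambda>s. LINT x|leb L. y s x * \<theta> x) t = (LINT x|leb L. prim T (\<lambda>s. y s x) t * \<theta> x)"
proof -
  have *: "(if s < t then c else 0) = c * (if s < t then 1 else 0)" for s c :: real
    by simp
  show ?thesis
    unfolding prim_def
    by (subst (1 2) *) (rule Fubini_mult[OF assms(1) L2_less assms(2)])
qed

text \<open>Joint measurability is what later permits exchanging the almost-everywhere quantifiers
  over time and space in the identity for the strain.\<close>

lemma prim_time_measurable:
  assumes y: "case_prod y \<in> borel_measurable (leb2 T L)"
  shows "(\<lambda>(t, x). prim T (\<lambda>s. y s x) t) \<in> borel_measurable (leb2 T L)"
proof -
  have "(\<lambda>q. case_prod y (snd q, snd (fst q))) \<in> borel_measurable (leb2 T L \<Otimes>\<^sub>M leb T)"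
    by (rule measurable_compose[OF _ y]) measurable
  then have [measurable]: "(\<lambda>q. y (snd q) (snd (fst q))) \<in> borel_measurable (leb2 T L \<Otimes>\<^sub>M leb T)"
    by (simp only: prod.case)
  have [measurable]: "(\<lambda>q. fst (fst q)) \<in> borel_measurable (leb2 T L \<Otimes>\<^sub>M leb T)"
    by (rule measurable_compose[OF measurable_fst measurable_fst_leb])
  have "(\<lambda>(p, s). if s < fst p then y s (snd p) else 0) \<in> borel_measurable (leb2 T L \<Otimes>\<^sub>M leb T)"
    unfolding case_prod_beta' by measurable
  then have "(\<lambda>p. LINT s|leb T. (if s < fst p then y s (snd p) else 0)) \<in> borel_measurable (leb2 T L)"
    by (rule leb.borel_measurable_lebesgue_integral)
  then show ?thesis
    by (simp add: prim_def case_prod_beta')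
qed

section \<open>The state equation almost everywhere\<close>

text \<open>
  Here \<open>z\<close>, \<open>y\<close>, \<open>r\<close> stand for \<open>u\<^sub>x\<close>, \<open>u\<^sub>x\<^sub>t\<close>, \<open>p\<^sub>x\<close>, and the test function \<open>q\<close> of the second
  equation is the primitive of \<open>h\<close>.
\<close>

definition strong_state :: "real \<Rightarrow> real \<Rightarrow> real \<Rightarrow> real \<Rightarrow> real \<Rightarrow> (real \<Rightarrow> real) \<Rightarrow>
    (real \<Rightarrow> real \<Rightarrow> real) \<Rightarrow> (real \<Rightarrow> real \<Rightarrow> real) \<Rightarrow> (real \<Rightarrow> real \<Rightarrow> real) \<Rightarrow>
    (real \<Rightarrow> real \<Rightarrow> real) \<Rightarrow> (real \<Rightarrow> real \<Rightarrow> real) \<Rightarrow> bool" where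
  "strong_state T L Hv He k \<psi> u p z y r \<longleftrightarrow>
     (\<forall>f\<in>{u, p, z, y, r}. case_prod f \<in> L2 (leb2 T L)) \<and>
     (AE t in leb T. AE x in leb L. u t x = prim L (z t) x) \<and>
     (AE t in leb T. AE x in leb L. p t x = prim L (r t) x) \<and>
     (AE t in leb T. AE x in leb L. p t x = Hv * y t x + He * z t x) \<and>
     (AE t in leb T. AE x in leb L. z t x = prim T (\<lambda>s. y s x) t) \<and>
     (AE t in leb T. \<forall>h\<in>L2 (leb L).
        (LINT x|leb L. y t x * prim L h x) + k * (LINT x|leb L. r t x * h x)
          + \<psi> t * (LINT x|leb L. h x) = 0)"

text \<open>Convergence in the H1 norm implies convergence of tested integrals by Cauchy-Schwarz.
  The function \<open>e\<close> stands for the derivative part of the norm, which only enlarges the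
  majorant.\<close>

lemma integral_test_limit:
  assumes c: "\<And>t. t \<in> {0..T} \<Longrightarrow> c t \<in> L2 (leb L)" and s: "s \<in> {0..T}"
    and lim: "((\<lambda>t. sqrt ((L2_norm (leb L) (\<lambda>x. c t x - c s x))\<^sup>2 + (e t)\<^sup>2)) \<longlongrightarrow> 0) (at s within {0..T})"
    and \<theta>: "\<theta> \<in> L2 (leb L)"
  shows "((\<lambda>t. LINT x|leb L. c t x * \<theta> x) \<longlongrightarrow> (LINT x|leb L. c s x * \<theta> x)) (at s within {0..T})"
proof -
  have "((\<lambda>t. (LINT x|leb L. c t x * \<theta> x) - (LINT x|leb L. c s x * \<theta> x)) \<longlongrightarrow> 0) (at s within {0..T})"
  proof (rule Lim_null_comparison)
    show "((\<lambda>t. sqrt ((L2_norm (leb L) (\<lambda>x. c t x - c s x))\<^sup>2 + (e t)\<^sup>2) * L2_norm (leb L) \<theta>) \<longlongrightarrow> 0)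
        (at s within {0..T})"
      using tendsto_mult_right[OF lim] by simp
    have "\<bar>(LINT x|leb L. c t x * \<theta> x) - (LINT x|leb L. c s x * \<theta> x)\<bar> \<le>
        sqrt ((L2_norm (leb L) (\<lambda>x. c t x - c s x))\<^sup>2 + (e t)\<^sup>2) * L2_norm (leb L) \<theta>"
      if t: "t \<in> {0..T}" for t
    proof -
      have "(LINT x|leb L. c t x * \<theta> x) - (LINT x|leb L. c s x * \<theta> x) =
          (LINT x|leb L. (c t x - c s x) * \<theta> x)"
        using L2_integrable_mult[OF c[OF t] \<theta>] L2_integrable_mult[OF c[OF s] \<theta>]
        by (simp add: left_diff_distrib)
      also have "\<bar>\<dots>\<bar> \<le> L2_norm (leb L) (\<lambda>x. c t x - c s x) * L2_norm (leb L) \<theta>"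
        by (rule L2_Cauchy_Schwarz[OF L2_diff[OF c[OF t] c[OF s]] \<theta>])
      also have "\<dots> \<le> sqrt ((L2_norm (leb L) (\<lambda>x. c t x - c s x))\<^sup>2 + (e t)\<^sup>2) * L2_norm (leb L) \<theta>"
        by (intro mult_right_mono L2_norm_nonneg real_le_rsqrt) simp
      finally show ?thesis .
    qed
    then show "\<forall>\<^sub>F t in at s within {0..T}. norm ((LINT x|leb L. c t x * \<theta> x) - (LINT x|leb L. c s x * \<theta> x))
        \<le> sqrt ((L2_norm (leb L) (\<lambda>x. c t x - c s x))\<^sup>2 + (e t)\<^sup>2) * L2_norm (leb L) \<theta>"
      by (auto simp: eventually_at_filter)
  qed
  then show ?thesis
    by (simp add: LIM_zero_iff)
qed

lemma weak_deriv_test: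
  "weak_deriv b v g \<Longrightarrow> test_fun b \<theta> \<Longrightarrow>
    (LINT x|leb b. v x * deriv \<theta> x) = - (LINT x|leb b. g x * \<theta> x)"
  by (simp add: weak_deriv_def)

lemma L2V0_AE: "L2V0 T L f fx \<Longrightarrow> AE t in leb T. f t \<in> V0 L \<and> weak_deriv L (f t) (fx t)"
  by (simp only: L2V0_def)

text \<open>The weak time derivative is known for \<open>u\<close> but not for \<open>ux\<close>, so
  the space derivative is first moved onto \<theta>. The resulting scalar function of time has a
  weak derivative, and is therefore a constant plus a primitive.\<close>

lemma tested_time_primitive:
  assumes T: "T > 0" and u: "L2V0 T L u ux" and ut: "L2V0 T L ut uxt"
    and wt: "weak_time_deriv T L u ut" and init: "initial_zero T L u" and \<theta>: "test_fun L \<theta>"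
  shows "AE t in leb T. (LINT x|leb L. ux t x * \<theta> x) = prim T (\<lambda>s. LINT x|leb L. uxt s x * \<theta> x) t"
proof -
  have L2: "case_prod u \<in> L2 (leb2 T L)" "case_prod ux \<in> L2 (leb2 T L)"
    "case_prod ut \<in> L2 (leb2 T L)" "case_prod uxt \<in> L2 (leb2 T L)"
    using u ut by (auto simp: L2V0_def L2L2_iff)
  have \<theta>L2: "\<theta> \<in> L2 (leb L)" "deriv \<theta> \<in> L2 (leb L)"
    using test_fun_L2[OF \<theta>] by auto
  let ?f = "\<lambda>t. LINT x|leb L. ux t x * \<theta> x" and ?g = "\<lambda>t. LINT x|leb L. uxt t x * \<theta> x"
  have f_int: "integrable (leb T) ?f" and g_int: "integrable (leb T) ?g"
    using L2 \<theta>L2 by (auto intro: integrable_space_integral)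
  have f_AE: "AE t in leb T. (LINT x|leb L. u t x * deriv \<theta> x) = - ?f t"
    using L2V0_AE[OF u] by eventually_elim (blast intro: weak_deriv_test[OF _ \<theta>])
  have g_AE: "AE t in leb T. (LINT x|leb L. ut t x * deriv \<theta> x) = - ?g t"
    using L2V0_AE[OF ut] by eventually_elim (blast intro: weak_deriv_test[OF _ \<theta>])
  have meas: "(\<lambda>t. LINT x|leb L. u t x * deriv \<theta> x) \<in> borel_measurable (leb T)"
    "(\<lambda>t. LINT x|leb L. ut t x * deriv \<theta> x) \<in> borel_measurable (leb T)"
    using integrable_space_integral L2 \<theta>L2 by blast+
  \<comment> \<open>Fubini is used twice, because the weak time derivative is an identity at almost
    every \<open>x\<close> while the test with \<theta> takes place at fixed
    \<open>t\<close>.\<close>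
  have fg: "(LINT t|leb T. ?f t * deriv \<phi> t) = - (LINT t|leb T. ?g t * \<phi> t)" if \<phi>: "test_fun T \<phi>" for \<phi>
  proof -
    have \<phi>L2: "\<phi> \<in> L2 (leb T)" "deriv \<phi> \<in> L2 (leb T)"
      using test_fun_L2[OF \<phi>] by auto
    note [measurable] = meas \<phi>L2[THEN L2_borel_measurable] f_int[THEN borel_measurable_integrable]
      g_int[THEN borel_measurable_integrable] \<theta>L2[THEN L2_borel_measurable]
    have "(LINT t|leb T. ?f t * deriv \<phi> t) = (LINT t|leb T. - ((LINT x|leb L. u t x * deriv \<theta> x) * deriv \<phi> t))"
      by (rule integral_cong_AE) (use f_AE in \<open>auto elim!: eventually_mono\<close>)
    also have "\<dots> = - (LINT x|leb L. (LINT t|leb T. u t x * deriv \<phi> t) * deriv \<theta> x)"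
      using Fubini_mult[OF L2(1) \<phi>L2(2) \<theta>L2(2)] by simp
    also have "(LINT x|leb L. (LINT t|leb T. u t x * deriv \<phi> t) * deriv \<theta> x) =
        (LINT x|leb L. - ((LINT t|leb T. ut t x * \<phi> t) * deriv \<theta> x))"
    proof (rule integral_cong_AE)
      have "AE x in leb L. (LINT t|leb T. u t x * deriv \<phi> t) = - (LINT t|leb T. ut t x * \<phi> t)"
        using wt \<phi> unfolding weak_time_deriv_def by blast
      then show "AE x in leb L. (LINT t|leb T. u t x * deriv \<phi> t) * deriv \<theta> x =
          - ((LINT t|leb T. ut t x * \<phi> t) * deriv \<theta> x)"
        by eventually_elim simp
      have [measurable]: "(\<lambda>x. LINT t|leb T. u t x * deriv \<phi> t) \<in> borel_measurable (leb L)"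
        "(\<lambda>x. LINT t|leb T. ut t x * \<phi> t) \<in> borel_measurable (leb L)"
        using lebs.integrable_snd[OF integrable_leb2_mult[OF L2(1) \<phi>L2(2) L2_const[OF finite_measure_leb, of 1]]]
          lebs.integrable_snd[OF integrable_leb2_mult[OF L2(3) \<phi>L2(1) L2_const[OF finite_measure_leb, of 1]]]
        by auto
      show "(\<lambda>x. (LINT t|leb T. u t x * deriv \<phi> t) * deriv \<theta> x) \<in> borel_measurable (leb L)"
        "(\<lambda>x. - ((LINT t|leb T. ut t x * \<phi> t) * deriv \<theta> x)) \<in> borel_measurable (leb L)"
        by measurable
    qed
    also have "- \<dots> = (LINT t|leb T. (LINT x|leb L. ut t x * deriv \<theta> x) * \<phi> t)"
      using Fubini_mult[OF L2(3) \<phi>L2(1) \<theta>L2(2)] by simp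
    also have "\<dots> = (LINT t|leb T. - (?g t * \<phi> t))"
      by (rule integral_cong_AE) (use g_AE in \<open>auto elim!: eventually_mono\<close>)
    finally show ?thesis by simp
  qed
  obtain m where m: "AE t in leb T. ?f t = m + prim T ?g t"
    using weak_primitive[OF T f_int g_int fg] by blast
  obtain c cx where c: "\<forall>t\<in>{0..T}. c t \<in> V0 L \<and> weak_deriv L (c t) (cx t)"
    and lim: "\<forall>s\<in>{0..T}. ((\<lambda>t. sqrt ((L2_norm (leb L) (\<lambda>x. c t x - c s x))\<^sup>2 +
        (L2_norm (leb L) (\<lambda>x. cx t x - cx s x))\<^sup>2)) \<longlongrightarrow> 0) (at s within {0..T})"
    and cu: "AE t in leb T. AE x in leb L. c t x = u t x" and c0: "AE x in leb L. c 0 x = 0"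
    using init unfolding initial_zero_def by blast
  have cL2: "c t \<in> L2 (leb L)" if "t \<in> {0..T}" for t
    using c that unfolding weak_deriv_def by blast
  have "((\<lambda>t. LINT x|leb L. c t x * deriv \<theta> x) \<longlongrightarrow> (LINT x|leb L. c 0 x * deriv \<theta> x)) (at 0 within {0..T})"
    using T lim by (intro integral_test_limit cL2 \<theta>L2) auto
  moreover have "(LINT x|leb L. c 0 x * deriv \<theta> x) = 0"
    by (rule integral_eq_zero_AE) (use c0 in \<open>auto elim!: eventually_mono\<close>)
  moreover have "(prim T ?g \<longlongrightarrow> prim T ?g 0) (at 0 within {0..T})"
    using continuous_on_prim[OF g_int, of "{0..T}"] T by (auto simp: continuous_on_def)
  ultimately have "((\<lambda>t. - (LINT x|leb L. c t x * deriv \<theta> x) - prim T ?g t) \<longlongrightarrow> - 0 - 0) (at 0 within {0..T})"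
    by (intro tendsto_diff tendsto_minus) (simp_all add: prim_0)
  moreover have "AE t in leb T. - (LINT x|leb L. c t x * deriv \<theta> x) - prim T ?g t = m"
  proof -
    have "AE t in leb T. t \<in> space (leb T)"
      by (rule AE_space)
    with m cu f_AE L2_leb2_slices(1)[OF L2(1)] show ?thesis
    proof eventually_elim
      case (elim t)
      have [measurable]: "c t \<in> borel_measurable (leb L)" "u t \<in> borel_measurable (leb L)"
        "deriv \<theta> \<in> borel_measurable (leb L)"
        using cL2[of t] elim \<theta>L2 by (auto simp: L2_def)
      have "(LINT x|leb L. c t x * deriv \<theta> x) = (LINT x|leb L. u t x * deriv \<theta> x)"
        by (rule integral_cong_AE) (use elim(2) in \<open>auto elim!: eventually_mono\<close>)
      then show ?case
        using elim by simp
    qed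
  qed
  \<comment> \<open>The continuous representative vanishes at time 0, so the constant of integration
    is 0.\<close>
  ultimately have "- 0 - 0 = m"
    using T by (intro AE_leb_limit[OF T, of 0]) auto
  then show ?thesis
    using m by simp
qed

text \<open>The exceptional times of the tested identity depend on the test function; a countable
  family of bumps leaves one common null set. At every other time Fubini moves the primitive inside
  the space integral, and the bumps separate the two sides.\<close>

lemma time_primitive:
  assumes T: "T > 0" "L > 0" and u: "L2V0 T L u ux" and ut: "L2V0 T L ut uxt"
    and wt: "weak_time_deriv T L u ut" and init: "initial_zero T L u"
  shows "AE t in leb T. AE x in leb L. ux t x = prim T (\<lambda>s. uxt s x) t"
proof -
  have ux: "case_prod ux \<in> L2 (leb2 T L)" and uxt: "case_prod uxt \<in> L2 (leb2 T L)"
    using u ut by (auto simp: L2V0_def L2L2_iff)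
  have "AE t in leb T. \<forall>n. \<forall>c\<in>\<rat>. (LINT x|leb L. ux t x * bump L (real (Suc n)) (max 0 c) x) =
      prim T (\<lambda>s. LINT x|leb L. uxt s x * bump L (real (Suc n)) (max 0 c) x) t"
    unfolding AE_all_countable
  proof (intro allI, subst AE_ball_countable[OF countable_rat], intro ballI)
    fix n and c :: real
    show "AE t in leb T. (LINT x|leb L. ux t x * bump L (real (Suc n)) (max 0 c) x) =
      prim T (\<lambda>s. LINT x|leb L. uxt s x * bump L (real (Suc n)) (max 0 c) x) t"
      by (intro tested_time_primitive[OF T(1) u ut wt init] test_fun_bump) auto
  qed
  with L2_leb2_slices(1)[OF ux] show ?thesis
  proof eventually_elim
    case (elim t)
    let ?Z = "\<lambda>x. prim T (\<lambda>s. uxt s x) t"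
    have Z: "integrable (leb L) ?Z"
      using uxt by (rule prim_time_integrable)
    have uxt_int: "integrable (leb L) (ux t)"
      using elim by (intro L2_leb_integrable)
    have "AE x in leb L. ux t x - ?Z x = 0"
    proof (rule AE_zero_if_bump_integrals_zero[OF T(2)])
      show "integrable (leb L) (\<lambda>x. ux t x - ?Z x)"
        using uxt_int Z by simp
      fix n and c :: real assume c: "c \<in> \<rat>"
      let ?\<theta> = "bump L (real (Suc n)) (max 0 c)"
      have \<theta>: "test_fun L ?\<theta>"
        by (intro test_fun_bump) auto
      have "(LINT x|leb L. ux t x * ?\<theta> x) = (LINT x|leb L. ?Z x * ?\<theta> x)"
        using elim c prim_time_Fubini[OF uxt test_fun_L2(1)[OF \<theta>]] by simp
      moreover have "integrable (leb L) (\<lambda>x. ux t x * ?\<theta> x)" "integrable (leb L) (\<lambda>x. ?Z x * ?\<theta> x)"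
        using uxt_int Z test_fun_continuous(1)[OF \<theta>] by (auto intro!: integrable_mult_continuous)
      ultimately show "(LINT x|leb L. ?\<theta> x * (ux t x - ?Z x)) = 0"
        by (simp add: algebra_simps)
    qed
    then show ?case
      by eventually_elim simp
  qed
qed

lemma weak_solution_strong_state:
  assumes T: "T > 0" "L > 0" and weak: "weak_solution T L Hv He k \<psi> u p"
  shows "\<exists>z y r. strong_state T L Hv He k \<psi> u p z y r"
proof -
  obtain ux ut uxt px where u: "L2V0 T L u ux" and ut: "L2V0 T L ut uxt"
    and wt: "weak_time_deriv T L u ut" and init: "initial_zero T L u" and p: "L2V0 T L p px"
    and eq: "AE t in leb T.
           (\<forall>v vx. v \<in> V0 L \<and> weak_deriv L v vx \<longrightarrow>
              (LINT x|leb L. (Hv * uxt t x + He * ux t x - p t x) * vx x) = 0) \<and>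
           (\<forall>q qx. q \<in> V0 L \<and> weak_deriv L q qx \<longrightarrow>
              (LINT x|leb L. uxt t x * q x) + k * (LINT x|leb L. px t x * qx x)
                + \<psi> t * point_val L q L = 0)"
    using weak unfolding weak_solution_def by blast
  have L2: "case_prod u \<in> L2 (leb2 T L)" "case_prod p \<in> L2 (leb2 T L)" "case_prod ux \<in> L2 (leb2 T L)"
    "case_prod uxt \<in> L2 (leb2 T L)" "case_prod px \<in> L2 (leb2 T L)"
    using u ut p by (auto simp: L2V0_def L2L2_iff)
  have "strong_state T L Hv He k \<psi> u p ux uxt px"
    unfolding strong_state_def
  proof (intro conjI)
    show "\<forall>f\<in>{u, p, ux, uxt, px}. case_prod f \<in> L2 (leb2 T L)"
      using L2 by simp
    show "AE t in leb T. AE x in leb L. u t x = prim L (ux t) x"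
      using L2V0_AE[OF u] by eventually_elim (blast intro: V0_eq_prim[OF T(2)])
    show "AE t in leb T. AE x in leb L. p t x = prim L (px t) x"
      using L2V0_AE[OF p] by eventually_elim (blast intro: V0_eq_prim[OF T(2)])
    show "AE t in leb T. AE x in leb L. ux t x = prim T (\<lambda>s. uxt s x) t"
      by (rule time_primitive[OF T u ut wt init])
    show "AE t in leb T. AE x in leb L. p t x = Hv * uxt t x + He * ux t x"
      using eq L2_leb2_slices(1)[OF L2(2)] L2_leb2_slices(1)[OF L2(3)] L2_leb2_slices(1)[OF L2(4)]
    proof eventually_elim
      case (elim t)
      \<comment> \<open>The residual is itself admissible as derivative of a test function, since
        derivatives of members of \<open>V0\<close> are arbitrary in \<open>L2\<close>. Its squared
        norm is then 0, and this includes the traction condition at \<open>L\<close>.\<close>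
      let ?h = "\<lambda>x. Hv * uxt t x + He * ux t x - p t x"
      have h: "?h \<in> L2 (leb L)"
        using elim by (intro L2_diff L2_lincomb)
      have "(LINT x|leb L. ?h x * ?h x) = 0"
        using elim(1) prim_V0[OF T(2) h] weak_deriv_prim[OF h] by blast
      then have "AE x in leb L. ?h x * ?h x = 0"
        using L2_integrable_mult[OF h h] by (subst (asm) integral_nonneg_eq_0_iff_AE) auto
      then show ?case
        by eventually_elim simp
    qed
    show "AE t in leb T. \<forall>h\<in>L2 (leb L).
        (LINT x|leb L. uxt t x * prim L h x) + k * (LINT x|leb L. px t x * h x)
          + \<psi> t * (LINT x|leb L. h x) = 0"
      using eq
    proof eventually_elim
      case (elim t)
      have "(LINT x|leb L. uxt t x * prim L h x) + k * (LINT x|leb L. px t x * h x)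
          + \<psi> t * (LINT x|leb L. h x) = 0" if h: "h \<in> L2 (leb L)" for h
      proof -
        have "point_val L (prim L h) L = (LINT x|leb L. h x)"
          using point_val_prim[OF T(2) h, of L] T(2) by (simp add: prim_end)
        then show ?thesis
          using elim prim_V0[OF T(2) h] weak_deriv_prim[OF h] by metis
      qed
      then show ?case by blast
    qed
  qed
  then show ?thesis by blast
qed

section \<open>Inequalities between slices and product norms, and a Poincare inequality\<close>

lemma AE_leb2I:
  assumes "case_prod f \<in> borel_measurable (leb2 T L)" "case_prod g \<in> borel_measurable (leb2 T L)"
    and "AE t in leb T. AE x in leb L. f t x = g t x"
  shows "AE q in leb2 T L. case_prod f q = (case_prod g q :: real)"
  using assms by (intro lebs.AE_pair_measure borel_measurable_eq) auto

lemma Fubini_prod: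
  assumes "case_prod f \<in> L2 (leb2 T L)" "case_prod g \<in> L2 (leb2 T L)"
  shows "(LINT t|leb T. LINT x|leb L. f t x * g t x) = (LINT q|leb2 T L. case_prod f q * case_prod g q)"
    "integrable (leb T) (\<lambda>t. LINT x|leb L. f t x * g t x)"
    "(LINT x|leb L. LINT t|leb T. f t x * g t x) = (LINT q|leb2 T L. case_prod f q * case_prod g q)"
proof -
  have i: "integrable (leb2 T L) (\<lambda>(t, x). f t x * g t x)"
    using L2_integrable_mult[OF assms] by (simp add: case_prod_beta')
  show "(LINT t|leb T. LINT x|leb L. f t x * g t x) = (LINT q|leb2 T L. case_prod f q * case_prod g q)"
    using lebs.integral_fst[OF i] by (simp add: case_prod_beta')
  show "integrable (leb T) (\<lambda>t. LINT x|leb L. f t x * g t x)"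
    using lebs.integrable_fst[OF i] by simp
  show "(LINT x|leb L. LINT t|leb T. f t x * g t x) = (LINT q|leb2 T L. case_prod f q * case_prod g q)"
    using lebs.integral_snd[OF i] by (simp add: case_prod_beta')
qed

lemma L2_norm_slices_le:
  assumes f: "case_prod f \<in> L2 (leb2 T L)" and g: "case_prod g \<in> L2 (leb2 T L)" and "c \<ge> 0"
    and le: "AE t in leb T. (LINT x|leb L. (f t x)\<^sup>2) \<le> c\<^sup>2 * (LINT x|leb L. (g t x)\<^sup>2)"
  shows "L2_norm (leb2 T L) (case_prod f) \<le> c * L2_norm (leb2 T L) (case_prod g)"
proof (rule power2_le_imp_le)
  have i: "integrable (leb T) (\<lambda>t. LINT x|leb L. (f t x)\<^sup>2)"
    "integrable (leb T) (\<lambda>t. LINT x|leb L. (g t x)\<^sup>2)"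
    using Fubini_prod(2)[OF f f] Fubini_prod(2)[OF g g] by (simp_all add: power2_eq_square)
  have "(LINT t|leb T. LINT x|leb L. (f t x)\<^sup>2) \<le> (LINT t|leb T. c\<^sup>2 * (LINT x|leb L. (g t x)\<^sup>2))"
    using i le by (intro integral_mono_AE) auto
  then show "(L2_norm (leb2 T L) (case_prod f))\<^sup>2 \<le> (c * L2_norm (leb2 T L) (case_prod g))\<^sup>2"
    unfolding power_mult_distrib L2_norm_power2 by (simp add: Fubini_power2[OF f] Fubini_power2[OF g])
  show "0 \<le> c * L2_norm (leb2 T L) (case_prod g)"
    using \<open>c \<ge> 0\<close> by (simp add: L2_norm_nonneg)
qed

lemma integral_leb_const: "b > 0 \<Longrightarrow> (LINT x|leb b. c) = b * (c :: real)"
  by (simp add: measure_restrict_space)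

lemma abs_integral_power2_le:
  assumes "b > 0" "g \<in> L2 (leb b)"
  shows "(LINT x|leb b. \<bar>g x\<bar>)\<^sup>2 \<le> b * (LINT x|leb b. (g x)\<^sup>2)"
proof -
  have "(\<lambda>x. \<bar>g x\<bar>) \<in> L2 (leb b)"
    using assms by (auto simp: L2_def)
  from L2_Cauchy_Schwarz_power2[OF L2_const[OF finite_measure_leb, of 1] this] show ?thesis
    using integral_leb_const[OF assms(1), of 1] by simp
qed

lemma integral_power2_le:
  assumes "b > 0" "g \<in> L2 (leb b)"
  shows "(LINT x|leb b. g x)\<^sup>2 \<le> b * (LINT x|leb b. (g x)\<^sup>2)"
  using L2_Cauchy_Schwarz_power2[OF L2_const[OF finite_measure_leb, of 1] assms(2)]
    integral_leb_const[OF assms(1), of 1] by simp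

lemma integral_prim_power2_le:
  assumes "b > 0" "g \<in> L2 (leb b)"
  shows "(LINT x|leb b. (prim b g x)\<^sup>2) \<le> b\<^sup>2 * (LINT x|leb b. (g x)\<^sup>2)"
proof -
  let ?A = "LINT x|leb b. \<bar>g x\<bar>"
  have g: "integrable (leb b) g"
    using assms(2) by (rule L2_leb_integrable)
  have "(prim b g x)\<^sup>2 \<le> ?A\<^sup>2" for x
    using abs_prim_le[OF g, of x] by (metis abs_ge_zero power2_abs power_mono)
  then have "(LINT x|leb b. (prim b g x)\<^sup>2) \<le> (LINT x|leb b. ?A\<^sup>2)"
    using L2_integrable_power2[OF continuous_L2[OF continuous_on_prim[OF g]]]
    by (intro integral_mono) auto
  also have "\<dots> = b * ?A\<^sup>2"
    by (rule integral_leb_const[OF assms(1)])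
  also have "\<dots> \<le> b * (b * (LINT x|leb b. (g x)\<^sup>2))"
    using assms abs_integral_power2_le[OF assms] by (intro mult_left_mono) auto
  finally show ?thesis
    by (simp add: power2_eq_square mult.assoc)
qed

lemma le_of_square_le:
  fixes k x c :: real
  assumes "k * x\<^sup>2 \<le> c * x" "0 \<le> x" "0 \<le> c"
  shows "k * x \<le> c"
proof (cases "x = 0")
  case False
  then have "(k * x) * x \<le> c * x" "x > 0"
    using assms by (auto simp: power2_eq_square mult.assoc)
  then show ?thesis by simp
qed (use assms in simp)

section \<open>Energy estimates\<close>

lemma strong_state_L2:
  assumes "strong_state T L Hv He k \<psi> u p z y r"
  shows "case_prod u \<in> L2 (leb2 T L)" "case_prod p \<in> L2 (leb2 T L)" "case_prod z \<in> L2 (leb2 T L)"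
    "case_prod y \<in> L2 (leb2 T L)" "case_prod r \<in> L2 (leb2 T L)"
  using assms by (simp_all add: strong_state_def)

lemma strong_state_monotone:
  assumes s: "strong_state T L Hv He k \<psi> u p z y r"
  shows "0 \<le> (LINT q|leb2 T L. case_prod y q * case_prod z q)"
proof -
  note L2 = strong_state_L2[OF s]
  have "AE t in leb T. AE x in leb L. z t x = prim T (\<lambda>s. y s x) t"
    using s by (simp add: strong_state_def)
  moreover have "{q \<in> space (leb2 T L). z (fst q) (snd q) = prim T (\<lambda>s. y s (snd q)) (fst q)} \<in> sets (leb2 T L)"
    using L2(3)[THEN L2_borel_measurable] prim_time_measurable[OF L2(4)[THEN L2_borel_measurable]]
    by (intro borel_measurable_eq) (simp_all add: case_prod_beta')
  ultimately have "AE x in leb L. AE t in leb T. z t x = prim T (\<lambda>s. y s x) t"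
    by (subst (asm) lebs.AE_commute)
  with L2_leb2_slices(2)[OF L2(4)] L2_leb2_slices(2)[OF L2(3)]
  have "AE x in leb L. 0 \<le> (LINT t|leb T. y t x * z t x)"
  proof eventually_elim
    case (elim x)
    let ?y = "\<lambda>t. y t x"
    have y: "integrable (leb T) ?y"
      using elim by (intro L2_leb_integrable)
    have [measurable]: "?y \<in> borel_measurable (leb T)" "(\<lambda>t. z t x) \<in> borel_measurable (leb T)"
      using elim by (auto simp: L2_def)
    have [measurable]: "prim T ?y \<in> borel_measurable (leb T)"
      by (intro continuous_measurable_leb continuous_on_prim y)
    have "(LINT t|leb T. y t x * z t x) = (LINT t|leb T. y t x * prim T ?y t)"
      by (rule integral_cong_AE) (use elim(3) in \<open>auto elim!: eventually_mono\<close>)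
    also have "\<dots> = (LINT t|leb T. y t x)\<^sup>2 / 2"
      by (rule prim_square[OF y])
    finally have eq: "(LINT t|leb T. y t x * z t x) = (LINT t|leb T. y t x)\<^sup>2 / 2" .
    show ?case
      unfolding eq by simp
  qed
  then have "0 \<le> (LINT x|leb L. LINT t|leb T. y t x * z t x)"
    by (rule integral_nonneg_AE)
  then show ?thesis
    by (simp add: Fubini_prod(3)[OF L2(4,3)])
qed

lemma strong_state_pressure:
  assumes s: "strong_state T L Hv He k \<psi> u p z y r" and f: "f \<in> L2 (leb2 T L)"
  shows "(LINT q|leb2 T L. case_prod p q * f q) =
    Hv * (LINT q|leb2 T L. case_prod y q * f q) + He * (LINT q|leb2 T L. case_prod z q * f q)"
proof -
  note L2 = strong_state_L2[OF s]
  note [measurable] = L2[THEN L2_borel_measurable] f[THEN L2_borel_measurable]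
  have "AE q in leb2 T L. case_prod p q = case_prod (\<lambda>t x. Hv * y t x + He * z t x) q"
    using s L2(2)[THEN L2_borel_measurable] L2_lincomb[OF L2(4,3), of Hv He, THEN L2_borel_measurable]
    by (intro AE_leb2I) (auto simp: strong_state_def case_prod_beta')
  then have "(LINT q|leb2 T L. case_prod p q * f q) =
      (LINT q|leb2 T L. Hv * (case_prod y q * f q) + He * (case_prod z q * f q))"
    by (intro integral_cong_AE)
      (auto elim!: eventually_mono simp: case_prod_beta' algebra_simps)
  then show ?thesis
    using L2_integrable_mult[OF L2(4) f] L2_integrable_mult[OF L2(3) f] by simp
qed

lemma strong_state_strain_le:
  assumes s: "strong_state T L Hv He k \<psi> u p z y r" and "He > 0" "Hv > 0"
  shows "He * L2_norm (leb2 T L) (case_prod z) \<le> L2_norm (leb2 T L) (case_prod p)"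
proof (rule le_of_square_le)
  note L2 = strong_state_L2[OF s]
  have "He * (L2_norm (leb2 T L) (case_prod z))\<^sup>2 \<le> (LINT q|leb2 T L. case_prod p q * case_prod z q)"
    unfolding strong_state_pressure[OF s L2(3)] L2_norm_power2
    using strong_state_monotone[OF s] assms(2,3) by (simp add: power2_eq_square)
  also have "\<dots> \<le> L2_norm (leb2 T L) (case_prod p) * L2_norm (leb2 T L) (case_prod z)"
    using L2_Cauchy_Schwarz[OF L2(2,3)] by simp
  finally show "He * (L2_norm (leb2 T L) (case_prod z))\<^sup>2
      \<le> L2_norm (leb2 T L) (case_prod p) * L2_norm (leb2 T L) (case_prod z)" .
qed (rule L2_norm_nonneg)+

lemma strong_state_flux_le:
  assumes s: "strong_state T L Hv He k \<psi> u p z y r" and pos: "L > 0" "He > 0" "Hv > 0"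
    and \<psi>: "\<psi> \<in> L2 (leb T)"
  shows "k * L2_norm (leb2 T L) (case_prod r) \<le> sqrt L * L2_norm (leb T) \<psi>"
proof (rule le_of_square_le)
  note L2 = strong_state_L2[OF s]
  let ?\<Psi> = "\<lambda>t x::real. \<psi> t"
  have \<Psi>: "case_prod ?\<Psi> \<in> L2 (leb2 T L)"
    using L2_pair_mult[OF \<psi> L2_const[OF finite_measure_leb, of 1]] by simp
  have norm_\<Psi>: "L2_norm (leb2 T L) (case_prod ?\<Psi>) = sqrt L * L2_norm (leb T) \<psi>"
  proof -
    have "(LINT q|leb2 T L. (case_prod ?\<Psi> q)\<^sup>2) = L * (LINT t|leb T. (\<psi> t)\<^sup>2)"
      using Fubini_power2[OF \<Psi>] unfolding integral_leb_const[OF pos(1)] by simp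
    then show ?thesis
      by (simp add: L2_norm_def real_sqrt_mult)
  qed
  have "AE t in leb T. (LINT x|leb L. y t x * p t x) + k * (LINT x|leb L. r t x * r t x)
      + (LINT x|leb L. \<psi> t * r t x) = 0"
  proof -
    have "AE t in leb T. AE x in leb L. p t x = prim L (r t) x"
      "AE t in leb T. \<forall>h\<in>L2 (leb L). (LINT x|leb L. y t x * prim L h x)
        + k * (LINT x|leb L. r t x * h x) + \<psi> t * (LINT x|leb L. h x) = 0"
      using s by (simp_all add: strong_state_def)
    with L2_leb2_slices(1)[OF L2(2)] L2_leb2_slices(1)[OF L2(4)] L2_leb2_slices(1)[OF L2(5)]
    show ?thesis
    proof eventually_elim
      case (elim t)
      have [measurable]: "y t \<in> borel_measurable (leb L)" "p t \<in> borel_measurable (leb L)"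
        "prim L (r t) \<in> borel_measurable (leb L)"
        using elim by (auto simp: L2_def intro!: continuous_measurable_leb continuous_on_prim L2_leb_integrable)
      have "(LINT x|leb L. y t x * p t x) = (LINT x|leb L. y t x * prim L (r t) x)"
        by (rule integral_cong_AE) (use elim(4) in \<open>auto elim!: eventually_mono\<close>)
      then show ?case
        using elim(3,5) by auto
    qed
  qed
  then have "(LINT t|leb T. (LINT x|leb L. y t x * p t x) + k * (LINT x|leb L. r t x * r t x)
      + (LINT x|leb L. \<psi> t * r t x)) = 0"
    by (rule integral_eq_zero_AE)
  then have "(LINT q|leb2 T L. case_prod y q * case_prod p q)
      + k * (LINT q|leb2 T L. case_prod r q * case_prod r q)
      + (LINT q|leb2 T L. case_prod ?\<Psi> q * case_prod r q) = 0"
    using Fubini_prod[OF L2(4,2)] Fubini_prod[OF L2(5,5)] Fubini_prod[OF \<Psi> L2(5)]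
    by simp
  moreover have "0 \<le> (LINT q|leb2 T L. case_prod y q * case_prod p q)"
  proof -
    have comm: "(LINT q|leb2 T L. case_prod y q * case_prod p q) = (LINT q|leb2 T L. case_prod p q * case_prod y q)"
      "(LINT q|leb2 T L. case_prod z q * case_prod y q) = (LINT q|leb2 T L. case_prod y q * case_prod z q)"
      by (simp_all only: mult.commute)
    show ?thesis
      unfolding comm(1) strong_state_pressure[OF s L2(4)] comm(2)
      using strong_state_monotone[OF s] pos by simp
  qed
  ultimately have "k * (L2_norm (leb2 T L) (case_prod r))\<^sup>2 \<le>
      \<bar>LINT q|leb2 T L. case_prod ?\<Psi> q * case_prod r q\<bar>"
    unfolding L2_norm_power2 unfolding power2_eq_square by linarith
  also have "\<dots> \<le> sqrt L * L2_norm (leb T) \<psi> * L2_norm (leb2 T L) (case_prod r)"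
    using L2_Cauchy_Schwarz[OF \<Psi> L2(5)] norm_\<Psi> by simp
  finally show "k * (L2_norm (leb2 T L) (case_prod r))\<^sup>2
      \<le> sqrt L * L2_norm (leb T) \<psi> * L2_norm (leb2 T L) (case_prod r)" .
  show "0 \<le> sqrt L * L2_norm (leb T) \<psi>"
    using pos by (simp add: L2_norm_nonneg)
qed (rule L2_norm_nonneg)

lemma primitive_L2_norm_le:
  assumes f: "case_prod f \<in> L2 (leb2 T L)" and g: "case_prod g \<in> L2 (leb2 T L)" and L: "L > 0"
    and prim: "AE t in leb T. AE x in leb L. f t x = prim L (g t) x"
  shows "L2_norm (leb2 T L) (case_prod f) \<le> L * L2_norm (leb2 T L) (case_prod g)"
proof (rule L2_norm_slices_le[OF f g])
  show "AE t in leb T. (LINT x|leb L. (f t x)\<^sup>2) \<le> L\<^sup>2 * (LINT x|leb L. (g t x)\<^sup>2)"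
    using prim L2_leb2_slices(1)[OF f] L2_leb2_slices(1)[OF g]
  proof eventually_elim
    case (elim t)
    have [measurable]: "f t \<in> borel_measurable (leb L)" "prim L (g t) \<in> borel_measurable (leb L)"
      using elim by (auto simp: L2_def intro!: continuous_measurable_leb continuous_on_prim L2_leb_integrable)
    have "(LINT x|leb L. (f t x)\<^sup>2) = (LINT x|leb L. (prim L (g t) x)\<^sup>2)"
      by (rule integral_cong_AE) (use elim(1) in \<open>auto elim!: eventually_mono\<close>)
    then show ?case
      using integral_prim_power2_le[OF L elim(3)] by simp
  qed
qed (use L in auto)

lemma strong_state_upper:
  assumes s: "strong_state T L Hv He k \<psi> u p z y r" and pos: "L > 0" "He > 0" "Hv > 0" "k > 0"
    and \<psi>: "\<psi> \<in> L2 (leb T)"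
  shows "L2_norm (leb2 T L) (case_prod p) \<le> L * sqrt L / k * L2_norm (leb T) \<psi>"
    "L2_norm (leb2 T L) (case_prod u) \<le> L / He * (L * sqrt L / k) * L2_norm (leb T) \<psi>"
proof -
  note L2 = strong_state_L2[OF s]
  have "L2_norm (leb2 T L) (case_prod p) \<le> L * L2_norm (leb2 T L) (case_prod r)"
    using s by (intro primitive_L2_norm_le L2 pos) (simp add: strong_state_def)
  also have "\<dots> \<le> L * (sqrt L * L2_norm (leb T) \<psi> / k)"
    using strong_state_flux_le[OF s pos(1-3) \<psi>] pos
    by (intro mult_left_mono) (auto simp: pos_le_divide_eq mult.commute)
  finally show p: "L2_norm (leb2 T L) (case_prod p) \<le> L * sqrt L / k * L2_norm (leb T) \<psi>"
    by simp
  have "L2_norm (leb2 T L) (case_prod u) \<le> L * L2_norm (leb2 T L) (case_prod z)"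
    using s by (intro primitive_L2_norm_le L2 pos) (simp add: strong_state_def)
  also have "\<dots> \<le> L * (L2_norm (leb2 T L) (case_prod p) / He)"
    using strong_state_strain_le[OF s pos(2,3)] pos
    by (intro mult_left_mono) (auto simp: pos_le_divide_eq mult.commute)
  also have "\<dots> \<le> L * (L * sqrt L / k * L2_norm (leb T) \<psi> / He)"
    using p pos by (intro mult_left_mono divide_right_mono) auto
  finally show "L2_norm (leb2 T L) (case_prod u) \<le> L / He * (L * sqrt L / k) * L2_norm (leb T) \<psi>"
    by (simp add: mult_ac)
qed

text \<open>
  The test function \<open>q\<close> with \<open>q' = 2 (L - x)\<close> has \<open>q(0) = 0\<close>, \<open>q'(L) = 0\<close> and constant \<open>q''\<close>, so that
  \<open>p\<^sub>x\<close> can be integrated by parts and \<open>\<psi>\<close> is expressed by \<open>u\<^sub>x\<^sub>t\<close> and \<open>p\<close> alone.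
\<close>

lemma strong_state_lower:
  assumes pos: "L > 0" "He > 0" "Hv > 0"
  shows "\<exists>K>0. \<forall>\<psi> u p z y r. strong_state T L Hv He k \<psi> u p z y r \<longrightarrow> \<psi> \<in> L2 (leb T) \<longrightarrow>
    (LINT t|leb T. (\<psi> t)\<^sup>2) \<le> K * (LINT q|leb2 T L. (case_prod p q)\<^sup>2)"
proof -
  let ?h = "\<lambda>x. 2 * (L - x)"
  have h: "?h \<in> L2 (leb L)"
    by (intro continuous_L2 continuous_intros)
  have E: "prim L ?h \<in> L2 (leb L)"
    by (intro continuous_L2 continuous_on_prim L2_leb_integrable h)
  define e where "e = (LINT x|leb L. (prim L ?h x)\<^sup>2)"
  have e: "e \<ge> 0"
    by (simp add: e_def)
  have int_h: "(LINT x|leb L. ?h x) = L\<^sup>2"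
  proof -
    have "(LINT x|leb L. ?h x) = (LINT x|leb L. (if 0 < x then ?h x else 0))"
      by (intro Bochner_Integration.integral_cong) auto
    also have "\<dots> = (2 * L * L - L\<^sup>2) - (2 * L * 0 - 0\<^sup>2)"
      using pos by (intro integral_deriv_leb[where \<phi> = "\<lambda>x. 2 * L * x - x\<^sup>2"])
        (auto intro!: derivative_eq_intros continuous_intros)
    finally show ?thesis
      by (simp add: power2_eq_square)
  qed
  define K where "K = (8 * e / Hv\<^sup>2 + 8 * k\<^sup>2 * L + 1) / L ^ 4"
  have K: "K > 0"
    using e pos by (auto simp: K_def intro!: divide_pos_pos add_nonneg_pos)
  show ?thesis
  proof (intro exI[of _ K] conjI K allI impI)
    fix \<psi> u p z y r assume s: "strong_state T L Hv He k \<psi> u p z y r" and \<psi>: "\<psi> \<in> L2 (leb T)"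
    note L2 = strong_state_L2[OF s]
    let ?P = "LINT q|leb2 T L. (case_prod p q)\<^sup>2" and ?Y = "LINT q|leb2 T L. (case_prod y q)\<^sup>2"
      and ?Z = "LINT q|leb2 T L. (case_prod z q)\<^sup>2"
    have "AE t in leb T. AE x in leb L. p t x = prim L (r t) x"
      "AE t in leb T. \<forall>h\<in>L2 (leb L). (LINT x|leb L. y t x * prim L h x)
        + k * (LINT x|leb L. r t x * h x) + \<psi> t * (LINT x|leb L. h x) = 0"
      using s by (simp_all add: strong_state_def)
    with L2_leb2_slices(1)[OF L2(2)] L2_leb2_slices(1)[OF L2(4)] L2_leb2_slices(1)[OF L2(5)]
    have "AE t in leb T. L ^ 4 * (\<psi> t)\<^sup>2 \<le>
        2 * e * (LINT x|leb L. (y t x)\<^sup>2) + 8 * k\<^sup>2 * L * (LINT x|leb L. (p t x)\<^sup>2)"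
    proof eventually_elim
      case (elim t)
      have r: "integrable (leb L) (r t)"
        using elim by (intro L2_leb_integrable)
      have [measurable]: "p t \<in> borel_measurable (leb L)" "prim L (r t) \<in> borel_measurable (leb L)"
        using elim(1) by (auto simp: L2_def intro!: continuous_measurable_leb continuous_on_prim r)
      have "(LINT x|leb L. prim L (r t) x * 2) = - (LINT x|leb L. r t x * (2 * (x - L)))"
        by (rule prim_by_parts[OF r]) (auto intro!: derivative_eq_intros)
      also have "\<dots> = (LINT x|leb L. r t x * ?h x)"
        by (subst Bochner_Integration.integral_minus[symmetric])
          (intro Bochner_Integration.integral_cong refl, simp add: algebra_simps)
      finally have "(LINT x|leb L. r t x * ?h x) = 2 * (LINT x|leb L. prim L (r t) x)"
        by simp
      also have "(LINT x|leb L. prim L (r t) x) = (LINT x|leb L. p t x)"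
        by (rule integral_cong_AE) (use elim(4) in \<open>auto elim!: eventually_mono\<close>)
      finally have "(LINT x|leb L. y t x * prim L ?h x) + k * (2 * (LINT x|leb L. p t x)) + \<psi> t * L\<^sup>2 = 0"
        using elim(5) h int_h by fastforce
      then have eq: "\<psi> t * L\<^sup>2 = - ((LINT x|leb L. y t x * prim L ?h x) + 2 * k * (LINT x|leb L. p t x))"
        by simp
      have "L ^ 4 * (\<psi> t)\<^sup>2 = (\<psi> t * L\<^sup>2)\<^sup>2"
        by (simp add: power_mult_distrib mult.commute)
      also have "\<dots> = ((LINT x|leb L. y t x * prim L ?h x) + 2 * k * (LINT x|leb L. p t x))\<^sup>2"
        unfolding eq by (rule power2_minus)
      also have "\<dots> \<le> 2 * (LINT x|leb L. y t x * prim L ?h x)\<^sup>2 + 2 * (2 * k * (LINT x|leb L. p t x))\<^sup>2"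
        using sum_squares_bound[of "LINT x|leb L. y t x * prim L ?h x" "2 * k * (LINT x|leb L. p t x)"]
        by (simp only: power2_sum)
      also have "\<dots> \<le> 2 * ((LINT x|leb L. (y t x)\<^sup>2) * e) + 8 * k\<^sup>2 * (L * (LINT x|leb L. (p t x)\<^sup>2))"
      proof (rule add_mono)
        show "2 * (LINT x|leb L. y t x * prim L ?h x)\<^sup>2 \<le> 2 * ((LINT x|leb L. (y t x)\<^sup>2) * e)"
          using L2_Cauchy_Schwarz_power2[OF elim(2) E] by (simp add: e_def)
        have "8 * k\<^sup>2 * (LINT x|leb L. p t x)\<^sup>2 \<le> 8 * k\<^sup>2 * (L * (LINT x|leb L. (p t x)\<^sup>2))"
          using integral_power2_le[OF pos(1) elim(1)] by (intro mult_left_mono) auto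
        then show "2 * (2 * k * (LINT x|leb L. p t x))\<^sup>2 \<le> 8 * k\<^sup>2 * (L * (LINT x|leb L. (p t x)\<^sup>2))"
          by (simp add: power_mult_distrib)
      qed
      finally show ?case
        by (simp add: mult_ac)
    qed
    moreover have int: "integrable (leb T) (\<lambda>t. LINT x|leb L. (y t x)\<^sup>2)"
      "integrable (leb T) (\<lambda>t. LINT x|leb L. (p t x)\<^sup>2)" "integrable (leb T) (\<lambda>t. (\<psi> t)\<^sup>2)"
      using Fubini_prod(2)[OF L2(4,4)] Fubini_prod(2)[OF L2(2,2)] \<psi>
      by (simp_all add: power2_eq_square L2_def)
    ultimately have "(LINT t|leb T. L ^ 4 * (\<psi> t)\<^sup>2) \<le> (LINT t|leb T.
        2 * e * (LINT x|leb L. (y t x)\<^sup>2) + 8 * k\<^sup>2 * L * (LINT x|leb L. (p t x)\<^sup>2))"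
      by (intro integral_mono_AE) auto
    then have "L ^ 4 * (LINT t|leb T. (\<psi> t)\<^sup>2) \<le> 2 * e * ?Y + 8 * k\<^sup>2 * L * ?P"
      using int by (simp add: Fubini_power2[OF L2(4)] Fubini_power2[OF L2(2)])
    moreover have "Hv\<^sup>2 * ?Y \<le> 4 * ?P"
    proof -
      have *: "(LINT q|leb2 T L. case_prod p q * case_prod p q) = ?P"
        "(LINT q|leb2 T L. case_prod y q * case_prod y q) = ?Y"
        "(LINT q|leb2 T L. case_prod z q * case_prod z q) = ?Z"
        by (simp_all add: power2_eq_square)
      have comm: "(LINT q|leb2 T L. case_prod z q * case_prod y q) = (LINT q|leb2 T L. case_prod y q * case_prod z q)"
        "(LINT q|leb2 T L. case_prod z q * case_prod p q) = (LINT q|leb2 T L. case_prod p q * case_prod z q)"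
        "(LINT q|leb2 T L. case_prod y q * case_prod p q) = (LINT q|leb2 T L. case_prod p q * case_prod y q)"
        by (simp_all only: mult.commute)
      let ?YZ = "LINT q|leb2 T L. case_prod y q * case_prod z q"
      have "?P = Hv * (Hv * ?Y + He * ?YZ) + He * (Hv * ?YZ + He * ?Z)"
        using strong_state_pressure[OF s L2(2)] strong_state_pressure[OF s L2(3)]
          strong_state_pressure[OF s L2(4)] by (simp add: * comm)
      then have "?P = Hv\<^sup>2 * ?Y + 2 * (Hv * He * ?YZ) + He\<^sup>2 * ?Z"
        by (simp add: power2_eq_square algebra_simps)
      moreover have "0 \<le> Hv * He * ?YZ" "0 \<le> He\<^sup>2 * ?Z" "0 \<le> ?P"
        using strong_state_monotone[OF s] pos by simp_all
      ultimately show ?thesis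
        by linarith
    qed
    ultimately have "L ^ 4 * (LINT t|leb T. (\<psi> t)\<^sup>2) \<le> 2 * e * (4 * ?P / Hv\<^sup>2) + 8 * k\<^sup>2 * L * ?P"
      using e pos
      by (smt (verit, best) mult_left_mono pos_le_divide_eq mult.commute zero_less_power)
    also have "\<dots> \<le> (8 * e / Hv\<^sup>2 + 8 * k\<^sup>2 * L + 1) * ?P"
      by (simp add: algebra_simps)
    finally show "(LINT t|leb T. (\<psi> t)\<^sup>2) \<le> K * ?P"
      using pos by (simp add: K_def field_simps)
  qed
qed

section \<open>The reduced cost functional\<close>

text \<open>Linearity is required only up to null sets, since solutions are determined only up to null sets.\<close>

definition L2_linear_map :: "'a measure \<Rightarrow> 'b measure \<Rightarrow> (('a \<Rightarrow> real) \<Rightarrow> 'b \<Rightarrow> real) \<Rightarrow> bool" where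
  "L2_linear_map M N U \<longleftrightarrow> (\<forall>f\<in>L2 M. U f \<in> L2 N) \<and>
     (\<forall>f\<in>L2 M. \<forall>g\<in>L2 M. \<forall>a b. AE q in N. U (\<lambda>x. a * f x + b * g x) q = a * U f q + b * U g q) \<and>
     (\<exists>K. \<forall>f\<in>L2 M. L2_norm N (U f) \<le> K * L2_norm M f)"

lemma L2_dual_pairing:
  assumes U: "L2_linear_map M N U" and a: "a \<in> L2 N"
  shows "(\<lambda>f. LINT q|N. U f q * a q) \<in> L2_dual M"
proof -
  have UL2: "U f \<in> L2 N" if "f \<in> L2 M" for f
    using U that unfolding L2_linear_map_def by blast
  have lin: "(LINT q|N. U (\<lambda>x. c * f x + d * g x) q * a q) =
      c * (LINT q|N. U f q * a q) + d * (LINT q|N. U g q * a q)" if fg: "f \<in> L2 M" "g \<in> L2 M" for f g c d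
  proof -
    note [measurable] = UL2[OF fg(1), THEN L2_borel_measurable] UL2[OF fg(2), THEN L2_borel_measurable]
      UL2[OF L2_lincomb[OF fg], THEN L2_borel_measurable] a[THEN L2_borel_measurable]
    have AE: "AE q in N. U (\<lambda>x. c * f x + d * g x) q = c * U f q + d * U g q"
      using U fg unfolding L2_linear_map_def by blast
    have "(LINT q|N. U (\<lambda>x. c * f x + d * g x) q * a q) = (LINT q|N. c * (U f q * a q) + d * (U g q * a q))"
      by (rule integral_cong_AE) (use AE in \<open>auto elim!: eventually_mono simp: algebra_simps\<close>)
    then show ?thesis
      using L2_integrable_mult[OF UL2[OF fg(1)] a] L2_integrable_mult[OF UL2[OF fg(2)] a] by simp
  qed
  obtain K where K: "\<forall>f\<in>L2 M. L2_norm N (U f) \<le> K * L2_norm M f"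
    using U unfolding L2_linear_map_def by blast
  have "\<bar>LINT q|N. U f q * a q\<bar> \<le> (K * L2_norm N a) * L2_norm M f" if f: "f \<in> L2 M" for f
  proof -
    have "\<bar>LINT q|N. U f q * a q\<bar> \<le> L2_norm N (U f) * L2_norm N a"
      by (rule L2_Cauchy_Schwarz[OF UL2[OF f] a])
    also have "\<dots> \<le> (K * L2_norm M f) * L2_norm N a"
      using K f by (intro mult_right_mono L2_norm_nonneg) auto
    finally show ?thesis
      by (simp add: mult_ac)
  qed
  then show ?thesis
    unfolding L2_dual_def using lin by blast
qed

lemma L2_bilinear_pairing:
  assumes U: "L2_linear_map M N U"
  shows "L2_bilinear M (\<lambda>f g. LINT q|N. U f q * U g q)"
  unfolding L2_bilinear_def
proof (intro conjI ballI)
  have UL2: "U f \<in> L2 N" if "f \<in> L2 M" for f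
    using U that unfolding L2_linear_map_def by blast
  fix f assume f: "f \<in> L2 M"
  show "(\<lambda>g. LINT q|N. U g q * U f q) \<in> L2_dual M"
    by (rule L2_dual_pairing[OF U UL2[OF f]])
  then show "(\<lambda>g. LINT q|N. U f q * U g q) \<in> L2_dual M"
    by (simp only: mult.commute)
next
  have UL2: "U f \<in> L2 N" if "f \<in> L2 M" for f
    using U that unfolding L2_linear_map_def by blast
  obtain K where K: "\<forall>f\<in>L2 M. L2_norm N (U f) \<le> K * L2_norm M f"
    using U unfolding L2_linear_map_def by blast
  have "\<bar>LINT q|N. U f q * U g q\<bar> \<le> K\<^sup>2 * L2_norm M f * L2_norm M g" if fg: "f \<in> L2 M" "g \<in> L2 M" for f g
  proof -
    have "\<bar>LINT q|N. U f q * U g q\<bar> \<le> L2_norm N (U f) * L2_norm N (U g)"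
      by (rule L2_Cauchy_Schwarz[OF UL2[OF fg(1)] UL2[OF fg(2)]])
    also have "\<dots> \<le> (K * L2_norm M f) * (K * L2_norm M g)"
      using K fg by (intro mult_mono' L2_norm_nonneg) auto
    finally show ?thesis
      by (simp add: mult_ac power2_eq_square)
  qed
  then show "\<exists>K. \<forall>f\<in>L2 M. \<forall>g\<in>L2 M. \<bar>LINT q|N. U f q * U g q\<bar> \<le> K * L2_norm M f * L2_norm M g"
    by blast
qed

lemma L2_bilinear_add:
  assumes "L2_bilinear M B" "L2_bilinear M B'"
  shows "L2_bilinear M (\<lambda>f g. B f g + B' f g)"
proof -
  obtain K K' where K: "\<forall>f\<in>L2 M. \<forall>g\<in>L2 M. \<bar>B f g\<bar> \<le> K * L2_norm M f * L2_norm M g"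
    "\<forall>f\<in>L2 M. \<forall>g\<in>L2 M. \<bar>B' f g\<bar> \<le> K' * L2_norm M f * L2_norm M g"
    using assms unfolding L2_bilinear_def by blast
  have "\<bar>B f g + B' f g\<bar> \<le> (K + K') * L2_norm M f * L2_norm M g" if "f \<in> L2 M" "g \<in> L2 M" for f g
  proof -
    have "\<bar>B f g + B' f g\<bar> \<le> K * L2_norm M f * L2_norm M g + K' * L2_norm M f * L2_norm M g"
      using K that by (intro order_trans[OF abs_triangle_ineq] add_mono) auto
    then show ?thesis
      by (simp add: algebra_simps)
  qed
  then show ?thesis
    using assms unfolding L2_bilinear_def by (auto intro!: L2_dual_add_fun)
qed

lemma L2_hess_least_squares:
  assumes U: "L2_linear_map M N U" and P: "L2_linear_map M N P" and a: "a \<in> L2 N" "b \<in> L2 N"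
    and J: "\<And>v. v \<in> L2 M \<Longrightarrow> J v = 1 / 2 * (LINT q|N. (U v q + a q)\<^sup>2) + 1 / 2 * (LINT q|N. (P v q + b q)\<^sup>2)"
    and w: "w \<in> L2 M" "\<xi> \<in> L2 M" "\<phi> \<in> L2 M"
  shows "L2_hess M J w \<xi> \<phi> = (LINT q|N. U \<xi> q * U \<phi> q) + (LINT q|N. P \<xi> q * P \<phi> q)"
proof -
  have expand: "1 / 2 * (LINT q|N. (V v q + c q)\<^sup>2) =
      1 / 2 * (LINT q|N. (c q)\<^sup>2) + (LINT q|N. V v q * c q) + 1 / 2 * (LINT q|N. V v q * V v q)"
    if V: "L2_linear_map M N V" and c: "c \<in> L2 N" and v: "v \<in> L2 M" for V c v
  proof -
    have Vv: "V v \<in> L2 N"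
      using V v unfolding L2_linear_map_def by blast
    have "(LINT q|N. (V v q + c q)\<^sup>2) = (LINT q|N. V v q * V v q + (c q)\<^sup>2 + 2 * (V v q * c q))"
      by (intro Bochner_Integration.integral_cong refl) (simp add: power2_eq_square algebra_simps)
    also have "\<dots> = (LINT q|N. V v q * V v q) + (LINT q|N. (c q)\<^sup>2) + 2 * (LINT q|N. V v q * c q)"
      using L2_integrable_mult[OF Vv Vv] L2_integrable_mult[OF Vv c] c by (simp add: L2_def)
    finally show ?thesis by simp
  qed
  show ?thesis
  proof (rule L2_hess_quadratic[OF L2_bilinear_add[OF L2_bilinear_pairing[OF U] L2_bilinear_pairing[OF P]]
        _ L2_dual_add_fun[OF L2_dual_pairing[OF U a(1)] L2_dual_pairing[OF P a(2)]] _ w])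
    show "(LINT q|N. U f q * U g q) + (LINT q|N. P f q * P g q) =
        (LINT q|N. U g q * U f q) + (LINT q|N. P g q * P f q)" for f g
      by (simp only: mult.commute)
    fix v assume v: "v \<in> L2 M"
    show "J v = (1 / 2 * (LINT q|N. (a q)\<^sup>2) + 1 / 2 * (LINT q|N. (b q)\<^sup>2)) +
        ((LINT q|N. U v q * a q) + (LINT q|N. P v q * b q)) +
        1 / 2 * ((LINT q|N. U v q * U v q) + (LINT q|N. P v q * P v q))"
      unfolding J[OF v] expand[OF U a(1) v] expand[OF P a(2) v] by (simp add: algebra_simps)
  qed
qed

lemma strong_state_lincomb:
  assumes s: "strong_state T L Hv He k \<psi> u p z y r" and s': "strong_state T L Hv He k \<psi>' u' p' z' y' r'"
  shows "strong_state T L Hv He k (\<lambda>t. a * \<psi> t + b * \<psi>' t) (\<lambda>t x. a * u t x + b * u' t x)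
    (\<lambda>t x. a * p t x + b * p' t x) (\<lambda>t x. a * z t x + b * z' t x)
    (\<lambda>t x. a * y t x + b * y' t x) (\<lambda>t x. a * r t x + b * r' t x)"
proof -
  note L2 = strong_state_L2[OF s] and L2' = strong_state_L2[OF s']
  have lin: "case_prod (\<lambda>t x. a * f t x + b * f' t x) \<in> L2 (leb2 T L)"
    if "case_prod f \<in> L2 (leb2 T L)" "case_prod f' \<in> L2 (leb2 T L)" for f f'
    using L2_lincomb[OF that, of a b] by (simp add: case_prod_beta')
  have prim: "AE t in leb T. AE x in leb L. a * f t x + b * f' t x = prim L (\<lambda>x. a * g t x + b * g' t x) x"
    if "AE t in leb T. AE x in leb L. f t x = prim L (g t) x"
      "AE t in leb T. AE x in leb L. f' t x = prim L (g' t) x"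
      "case_prod g \<in> L2 (leb2 T L)" "case_prod g' \<in> L2 (leb2 T L)" for f f' g g'
    using that(1,2) L2_leb2_slices(1)[OF that(3)] L2_leb2_slices(1)[OF that(4)]
  proof eventually_elim
    case (elim t)
    then have "prim L (\<lambda>x. a * g t x + b * g' t x) x = a * prim L (g t) x + b * prim L (g' t) x" for x
      by (intro prim_lincomb L2_leb_integrable)
    then show ?case
      using elim(1,2) by (auto elim: eventually_elim2)
  qed
  show ?thesis
    unfolding strong_state_def
  proof (intro conjI)
    show "\<forall>f\<in>{\<lambda>t x. a * u t x + b * u' t x, \<lambda>t x. a * p t x + b * p' t x, \<lambda>t x. a * z t x + b * z' t x,
        \<lambda>t x. a * y t x + b * y' t x, \<lambda>t x. a * r t x + b * r' t x}. case_prod f \<in> L2 (leb2 T L)"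
      using lin L2 L2' by (simp only: ball_simps simp_thms)
    show "AE t in leb T. AE x in leb L. a * u t x + b * u' t x = prim L (\<lambda>x. a * z t x + b * z' t x) x"
      using s s' by (intro prim L2 L2') (simp_all add: strong_state_def)
    show "AE t in leb T. AE x in leb L. a * p t x + b * p' t x = prim L (\<lambda>x. a * r t x + b * r' t x) x"
      using s s' by (intro prim L2 L2') (simp_all add: strong_state_def)
    have "AE t in leb T. AE x in leb L. p t x = Hv * y t x + He * z t x"
      "AE t in leb T. AE x in leb L. p' t x = Hv * y' t x + He * z' t x"
      using s s' by (simp_all add: strong_state_def)
    then show "AE t in leb T. AE x in leb L. a * p t x + b * p' t x =
        Hv * (a * y t x + b * y' t x) + He * (a * z t x + b * z' t x)"
    proof eventually_elim
      case (elim t)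
      then show ?case
        by eventually_elim (simp add: algebra_simps)
    qed
    have "AE x in leb L. \<forall>t. prim T (\<lambda>s. a * y s x + b * y' s x) t =
        a * prim T (\<lambda>s. y s x) t + b * prim T (\<lambda>s. y' s x) t"
      using L2_leb2_slices(2)[OF L2(4)] L2_leb2_slices(2)[OF L2'(4)]
      by eventually_elim (intro allI prim_lincomb L2_leb_integrable)
    moreover have "AE t in leb T. AE x in leb L. z t x = prim T (\<lambda>s. y s x) t"
      "AE t in leb T. AE x in leb L. z' t x = prim T (\<lambda>s. y' s x) t"
      using s s' by (simp_all add: strong_state_def)
    ultimately show "AE t in leb T. AE x in leb L. a * z t x + b * z' t x =
        prim T (\<lambda>s. a * y s x + b * y' s x) t"
    proof -
      assume lin: "AE x in leb L. \<forall>t. prim T (\<lambda>s. a * y s x + b * y' s x) t =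
        a * prim T (\<lambda>s. y s x) t + b * prim T (\<lambda>s. y' s x) t"
      assume "AE t in leb T. AE x in leb L. z t x = prim T (\<lambda>s. y s x) t"
        "AE t in leb T. AE x in leb L. z' t x = prim T (\<lambda>s. y' s x) t"
      then show ?thesis
      proof eventually_elim
        case (elim t)
        with lin show ?case
          by eventually_elim simp
      qed
    qed
    have "AE t in leb T. \<forall>h\<in>L2 (leb L). (LINT x|leb L. y t x * prim L h x)
        + k * (LINT x|leb L. r t x * h x) + \<psi> t * (LINT x|leb L. h x) = 0"
      "AE t in leb T. \<forall>h\<in>L2 (leb L). (LINT x|leb L. y' t x * prim L h x)
        + k * (LINT x|leb L. r' t x * h x) + \<psi>' t * (LINT x|leb L. h x) = 0"
      using s s' by (simp_all add: strong_state_def)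
    with L2_leb2_slices(1)[OF L2(4)] L2_leb2_slices(1)[OF L2'(4)] L2_leb2_slices(1)[OF L2(5)]
      L2_leb2_slices(1)[OF L2'(5)]
    show "AE t in leb T. \<forall>h\<in>L2 (leb L). (LINT x|leb L. (a * y t x + b * y' t x) * prim L h x)
        + k * (LINT x|leb L. (a * r t x + b * r' t x) * h x)
        + (a * \<psi> t + b * \<psi>' t) * (LINT x|leb L. h x) = 0"
    proof eventually_elim
      case (elim t)
      show ?case
      proof
        fix h assume h: "h \<in> L2 (leb L)"
        have ph: "prim L h \<in> L2 (leb L)"
          by (intro continuous_L2 continuous_on_prim L2_leb_integrable h)
        have lin: "(LINT x|leb L. (a * f x + b * f' x) * g x) =
            a * (LINT x|leb L. f x * g x) + b * (LINT x|leb L. f' x * g x)"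
          if "f \<in> L2 (leb L)" "f' \<in> L2 (leb L)" "g \<in> L2 (leb L)" for f f' g
        proof -
          have "(LINT x|leb L. (a * f x + b * f' x) * g x) =
              (LINT x|leb L. a * (f x * g x) + b * (f' x * g x))"
            by (simp add: algebra_simps)
          then show ?thesis
            using L2_integrable_mult[OF that(1,3)] L2_integrable_mult[OF that(2,3)] by simp
        qed
        have "(LINT x|leb L. (a * y t x + b * y' t x) * prim L h x)
          + k * (LINT x|leb L. (a * r t x + b * r' t x) * h x)
          + (a * \<psi> t + b * \<psi>' t) * (LINT x|leb L. h x) =
          a * ((LINT x|leb L. y t x * prim L h x) + k * (LINT x|leb L. r t x * h x) + \<psi> t * (LINT x|leb L. h x))
          + b * ((LINT x|leb L. y' t x * prim L h x) + k * (LINT x|leb L. r' t x * h x) + \<psi>' t * (LINT x|leb L. h x))"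
          unfolding lin[OF elim(1,2) ph] lin[OF elim(3,4) h] by (simp add: algebra_simps)
        then show "(LINT x|leb L. (a * y t x + b * y' t x) * prim L h x)
          + k * (LINT x|leb L. (a * r t x + b * r' t x) * h x)
          + (a * \<psi> t + b * \<psi>' t) * (LINT x|leb L. h x) = 0"
          using elim(5,6) h by simp
      qed
    qed
  qed
qed

lemma L2_norm_zero_AE:
  assumes "f \<in> L2 M" "L2_norm M f \<le> 0"
  shows "AE x in M. f x = 0"
proof -
  have "(LINT x|M. (f x)\<^sup>2) = 0"
    using assms(2) L2_norm_nonneg[of M f] L2_norm_power2[of M f] by simp
  then have "AE x in M. (f x)\<^sup>2 = 0"
    using L2_integrable_power2[OF assms(1)] by (subst (asm) integral_nonneg_eq_0_iff_AE) auto
  then show ?thesis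
    by simp
qed

lemma strong_state_unique:
  assumes s: "strong_state T L Hv He k \<psi> u p z y r" and s': "strong_state T L Hv He k \<psi> u' p' z' y' r'"
    and pos: "L > 0" "He > 0" "Hv > 0" "k > 0"
  shows "AE q in leb2 T L. case_prod u q = case_prod u' q" "AE q in leb2 T L. case_prod p q = case_prod p' q"
proof -
  have d: "strong_state T L Hv He k (\<lambda>t. 1 * \<psi> t + - 1 * \<psi> t) (\<lambda>t x. 1 * u t x + - 1 * u' t x)
    (\<lambda>t x. 1 * p t x + - 1 * p' t x) (\<lambda>t x. 1 * z t x + - 1 * z' t x)
    (\<lambda>t x. 1 * y t x + - 1 * y' t x) (\<lambda>t x. 1 * r t x + - 1 * r' t x)"
    by (rule strong_state_lincomb[OF s s'])
  have 0: "(\<lambda>t. 1 * \<psi> t + - 1 * \<psi> t) \<in> L2 (leb T)" "L2_norm (leb T) (\<lambda>t. 1 * \<psi> t + - 1 * \<psi> t) = 0"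
    by (simp_all add: L2_def L2_norm_def)
  show "AE q in leb2 T L. case_prod u q = case_prod u' q"
    using L2_norm_zero_AE[OF strong_state_L2(1)[OF d]] strong_state_upper(2)[OF d pos 0(1)]
    unfolding 0(2) by (simp add: case_prod_beta')
  show "AE q in leb2 T L. case_prod p q = case_prod p' q"
    using L2_norm_zero_AE[OF strong_state_L2(2)[OF d]] strong_state_upper(1)[OF d pos 0(1)]
    unfolding 0(2) by (simp add: case_prod_beta')
qed

lemma solution_map_linear:
  assumes pos: "L > 0" "He > 0" "Hv > 0" "k > 0"
    and G: "\<And>\<psi>. \<psi> \<in> L2 (leb T) \<Longrightarrow> \<exists>z y r. strong_state T L Hv He k \<psi> (fst (G \<psi>)) (snd (G \<psi>)) z y r"
  shows "L2_linear_map (leb T) (leb2 T L) (\<lambda>\<psi>. case_prod (fst (G \<psi>)))"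
    "L2_linear_map (leb T) (leb2 T L) (\<lambda>\<psi>. case_prod (snd (G \<psi>)))"
proof -
  have lin: "(AE q in leb2 T L. case_prod (fst (G (\<lambda>x. a * f x + b * g x))) q =
        a * case_prod (fst (G f)) q + b * case_prod (fst (G g)) q) \<and>
      (AE q in leb2 T L. case_prod (snd (G (\<lambda>x. a * f x + b * g x))) q =
        a * case_prod (snd (G f)) q + b * case_prod (snd (G g)) q)"
    if fg: "f \<in> L2 (leb T)" "g \<in> L2 (leb T)" for f g a b
  proof -
    obtain z y r z' y' r' z'' y'' r''
      where s: "strong_state T L Hv He k f (fst (G f)) (snd (G f)) z y r"
        "strong_state T L Hv He k g (fst (G g)) (snd (G g)) z' y' r'"
        "strong_state T L Hv He k (\<lambda>x. a * f x + b * g x) (fst (G (\<lambda>x. a * f x + b * g x)))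
          (snd (G (\<lambda>x. a * f x + b * g x))) z'' y'' r''"
      using G fg L2_lincomb[OF fg] by meson
    show ?thesis
      using strong_state_unique[OF s(3) strong_state_lincomb[OF s(1,2)] pos]
      by (simp add: case_prod_beta')
  qed
  have bound: "case_prod (fst (G f)) \<in> L2 (leb2 T L) \<and> case_prod (snd (G f)) \<in> L2 (leb2 T L) \<and>
      L2_norm (leb2 T L) (case_prod (fst (G f))) \<le> L / He * (L * sqrt L / k) * L2_norm (leb T) f \<and>
      L2_norm (leb2 T L) (case_prod (snd (G f))) \<le> L * sqrt L / k * L2_norm (leb T) f"
    if f: "f \<in> L2 (leb T)" for f
  proof -
    obtain z y r where s: "strong_state T L Hv He k f (fst (G f)) (snd (G f)) z y r"
      using G[OF f] by blast
    show ?thesis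
      using strong_state_L2(1,2)[OF s] strong_state_upper[OF s pos f] by simp
  qed
  show "L2_linear_map (leb T) (leb2 T L) (\<lambda>\<psi>. case_prod (fst (G \<psi>)))"
    "L2_linear_map (leb T) (leb2 T L) (\<lambda>\<psi>. case_prod (snd (G \<psi>)))"
    unfolding L2_linear_map_def using lin bound by blast+
qed

lemma indicator_norms:
  assumes "0 < \<epsilon>" "\<epsilon> < T"
  defines "\<psi> \<equiv> \<lambda>t. if t < \<epsilon> then 1 else 0 :: real"
  shows "\<psi> \<in> L2 (leb T)" "(LINT t|leb T. (\<psi> t)\<^sup>2) = \<epsilon>" "L1_norm (leb T) \<psi> = \<epsilon>"
proof -
  show "\<psi> \<in> L2 (leb T)"
    unfolding \<psi>_def by (rule L2_less)
  have "(LINT t|leb T. \<psi> t) = (LINT t|lborel. indicator {0<..<T} t *\<^sub>R \<psi> t)"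
    by (rule integral_restrict_space) simp
  also have "\<dots> = (LINT t|lborel. indicator {0<..<\<epsilon>} t)"
    using assms by (intro Bochner_Integration.integral_cong) (auto simp: indicator_def)
  also have "\<dots> = \<epsilon>"
    using assms by simp
  finally have "(LINT t|leb T. \<psi> t) = \<epsilon>" .
  moreover have "(\<psi> t)\<^sup>2 = \<psi> t" "\<bar>\<psi> t\<bar> = \<psi> t" for t
    by (auto simp: \<psi>_def)
  ultimately show "(LINT t|leb T. (\<psi> t)\<^sup>2) = \<epsilon>" "L1_norm (leb T) \<psi> = \<epsilon>"
    by (simp_all add: L1_norm_def)
qed

theorem theorem5p6:
  fixes T L k \<delta> lam_e mu_e lam_v mu_v He Hv :: real
    and G :: "(real \<Rightarrow> real) \<Rightarrow> (real \<Rightarrow> real \<Rightarrow> real) \<times> (real \<Rightarrow> real \<Rightarrow> real)"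
    and u_d p_d u_til p_til :: "real \<Rightarrow> real \<Rightarrow> real"
  assumes "T > 0" and "L > 0" and "k > 0" and "\<delta> > 0"
    and "lam_e > 0" and "mu_e > 0" and "lam_v > 0" and "mu_v > 0"
    and "He = lam_e + 2 * mu_e" and "Hv = \<delta> * (lam_v + 2 * mu_v)"
    and "u_d \<in> L2L2 T L" and "p_d \<in> L2L2 T L" and "u_til \<in> L2L2 T L" and "p_til \<in> L2L2 T L"
    and "\<And>\<psi>. \<psi> \<in> L2 (leb T) \<Longrightarrow> weak_solution T L Hv He k \<psi> (fst (G \<psi>)) (snd (G \<psi>))"
  shows "\<not> (\<exists>C>0. \<forall>w\<in>L2 (leb T). \<forall>\<xi>\<in>L2 (leb T). \<forall>\<phi>\<in>L2 (leb T).
           \<bar>L2_hess (leb T) (tracking_cost T L G u_til p_til u_d p_d) w \<xi> \<phi>\<bar>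
             \<le> C * L1_norm (leb T) \<xi> * L1_norm (leb T) \<phi>)"
proof
  let ?J = "tracking_cost T L G u_til p_til u_d p_d" and ?N = "leb2 T L"
  let ?U = "\<lambda>\<psi>. case_prod (fst (G \<psi>))" and ?P = "\<lambda>\<psi>. case_prod (snd (G \<psi>))"
  let ?a = "\<lambda>q. case_prod u_til q - case_prod u_d q" and ?b = "\<lambda>q. case_prod p_til q - case_prod p_d q"
  have pos: "L > 0" "He > 0" "Hv > 0" "k > 0"
    using assms by (auto intro!: mult_pos_pos add_pos_pos)
  have G: "\<exists>z y r. strong_state T L Hv He k \<psi> (fst (G \<psi>)) (snd (G \<psi>)) z y r" if "\<psi> \<in> L2 (leb T)" for \<psi>
    by (rule weak_solution_strong_state[OF assms(1,2) assms(15)[OF that]])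
  have U: "L2_linear_map (leb T) ?N ?U" and P: "L2_linear_map (leb T) ?N ?P"
    using solution_map_linear[OF pos G] by blast+
  have ab: "?a \<in> L2 ?N" "?b \<in> L2 ?N"
    using assms(11-14) unfolding L2L2_iff by - (rule L2_diff, assumption, assumption)+
  have J: "?J v = 1 / 2 * (LINT q|?N. (?U v q + ?a q)\<^sup>2) + 1 / 2 * (LINT q|?N. (?P v q + ?b q)\<^sup>2)"
    if v: "v \<in> L2 (leb T)" for v
  proof -
    have "case_prod (\<lambda>t x. fst (G v) t x + u_til t x - u_d t x) = (\<lambda>q. ?U v q + ?a q)"
      "case_prod (\<lambda>t x. snd (G v) t x + p_til t x - p_d t x) = (\<lambda>q. ?P v q + ?b q)"
      by (auto simp: fun_eq_iff)
    moreover have "(\<lambda>q. ?U v q + ?a q) \<in> L2 ?N" "(\<lambda>q. ?P v q + ?b q) \<in> L2 ?N"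
      using U P v ab unfolding L2_linear_map_def by (auto intro!: L2_add)
    ultimately show ?thesis
      unfolding tracking_cost_def by (simp add: L2L2_norm_power2)
  qed
  note hess = L2_hess_least_squares[OF U P ab J]
  obtain K where K: "K > 0" "\<And>\<psi> u p z y r. strong_state T L Hv He k \<psi> u p z y r \<Longrightarrow> \<psi> \<in> L2 (leb T) \<Longrightarrow>
      (LINT t|leb T. (\<psi> t)\<^sup>2) \<le> K * (LINT q|?N. (case_prod p q)\<^sup>2)"
    using strong_state_lower[OF pos(1-3)] by blast
  assume "\<exists>C>0. \<forall>w\<in>L2 (leb T). \<forall>\<xi>\<in>L2 (leb T). \<forall>\<phi>\<in>L2 (leb T).
    \<bar>L2_hess (leb T) ?J w \<xi> \<phi>\<bar> \<le> C * L1_norm (leb T) \<xi> * L1_norm (leb T) \<phi>"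
  then obtain C where C: "C > 0" "\<And>\<psi>. \<psi> \<in> L2 (leb T) \<Longrightarrow>
      \<bar>L2_hess (leb T) ?J \<psi> \<psi> \<psi>\<bar> \<le> C * L1_norm (leb T) \<psi> * L1_norm (leb T) \<psi>"
    by blast
  have L2_le_L1: "(LINT t|leb T. (\<psi> t)\<^sup>2) \<le> K * (C * L1_norm (leb T) \<psi> * L1_norm (leb T) \<psi>)"
    if \<psi>: "\<psi> \<in> L2 (leb T)" for \<psi>
  proof -
    have "(LINT t|leb T. (\<psi> t)\<^sup>2) \<le> K * (LINT q|?N. (?P \<psi> q)\<^sup>2)"
      using K(2) G[OF \<psi>] \<psi> by blast
    also have "(LINT q|?N. (?P \<psi> q)\<^sup>2) \<le> (LINT q|?N. ?U \<psi> q * ?U \<psi> q) + (LINT q|?N. ?P \<psi> q * ?P \<psi> q)"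
      by (simp add: power2_eq_square)
    also have "\<dots> = L2_hess (leb T) ?J \<psi> \<psi> \<psi>"
      by (rule hess[symmetric]) (use \<psi> in auto)
    also have "\<dots> \<le> C * L1_norm (leb T) \<psi> * L1_norm (leb T) \<psi>"
      using C(2)[OF \<psi>] by simp
    finally show ?thesis
      using K(1) by simp
  qed
  define \<epsilon> where "\<epsilon> = min (T / 2) (1 / (2 * K * C))"
  have \<epsilon>: "0 < \<epsilon>" "\<epsilon> < T" "\<epsilon> \<le> 1 / (2 * K * C)"
    using assms(1) K(1) C(1) by (auto simp: \<epsilon>_def)
  have "\<epsilon> \<le> K * (C * \<epsilon> * \<epsilon>)"
    using L2_le_L1[OF indicator_norms(1)[OF \<epsilon>(1,2)]] unfolding indicator_norms(2,3)[OF \<epsilon>(1,2)] .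
  also have "\<dots> = (K * C * \<epsilon>) * \<epsilon>"
    by simp
  also have "\<dots> \<le> 1 / 2 * \<epsilon>"
    using \<epsilon> K(1) C(1) by (intro mult_right_mono) (auto simp: field_simps)
  finally show False
    using \<epsilon>(1) by simp
qed

end
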